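(* Let $\mathscr{B}\subset\mathbb{N}$ be such that $\overline{d}(\mathcal{F}_{\mathscr{B}})>0$ and $$\overline{d}\Bigl(\bigcup_{b\in\mathscr{B},\, b\ge K}b\mathbb{Z}\Bigr)\to 0\quad\text{when } K\to\infty.$$ Assume moreover that $\mathscr{B}$ contains an infinite pairwise coprime subset. Then $(S,X_\eta)$ is hereditary and the simplex $\mathcal{P}(S,X_\eta)$ is Poulsen.
   Context: $\mathbb{N}=\{1,2,\dots\}$. For $\mathscr{B}\subset\mathbb{N}$, $\mathcal{F}_{\mathscr{B}}:=\mathbb{Z}\setminus\bigcup_{b\in\mathscr{B}}b\mathbb{Z}$ is the $\mathscr{B}$-free set, $\eta:=\mathbf{1}_{\mathcal{F}_{\mathscr{B}}}\in\{0,1\}^{\mathbb{Z}}$ is its characteristic function, and $X_\eta=\overline{\{S^k\eta : k\in\mathbb{Z}\}}\subset\{0,1\}^{\mathbb{Z}}$, where $S$ is the left translation (shift). For $A\subset\mathbb{Z}$, $\overline{d}(A)$ is the upper density of $A\cap\mathbb{N}$, i.e. $\limsup_{N\to\infty}\frac1N|A\cap\{1,\dots,N\}|$. A subshift $X\subset\{0,1\}^{\mathbb{Z}}$ (closed $S$-invariant set) is hereditary if $x\in X$, $y\in\{0,1\}^{\mathbb{Z}}$ and $y\le x$ coordinatewise imply $y\in X$. $\mathcal{P}(S,Y)$ is the set of $S$-invariant Borel probability measures on a subshift $Y$ with the weak topology (a Choquet simplex whose extreme points are the ergodic measures). A simplex is called Poulsen if it is non-trivial (has more than one point) and its set of extreme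 points is dense. *)

theory Defs
  imports "HOL-Probability.Probability"
begin

text \<open>
  A point of \<open>{0,1}\<close>-sequence space over the integers is a function of type \<open>int \<Rightarrow> bool\<close>
  with \<open>True\<close> for 1 and \<open>False\<close> for 0. The library instances give it exactly the required
  structure: \<open>bool\<close> is discrete, functions carry the product topology, and \<open>\<le>\<close> is the
  coordinatewise order.
\<close>

type_synonym config = "int \<Rightarrow> bool"

definition multiples :: "nat \<Rightarrow> int set" where
  "multiples b = range (\<lambda>k. int b * k)"

definition free_set :: "nat set \<Rightarrow> int set" where
  "free_set B = UNIV - (\<Union>b\<in>B. multiples b)"

definition eta :: "nat set \<Rightarrow> config" where
  "eta B = (\<lambda>n. n \<in> free_set B)"

definition upper_density :: "int set \<Rightarrow> ereal" where
  "upper_density A = limsup (\<lambda>N. ereal (real (card (A \<inter> {1..int N})) / real N))"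

text \<open>\<open>shift k\<close> is the \<open>k\<close>-th power of the left shift \<open>S = shift 1\<close>, for every integer \<open>k\<close>.\<close>

definition shift :: "int \<Rightarrow> config \<Rightarrow> config" where
  "shift k x = (\<lambda>n. x (n + k))"

lemma shift_0: "shift 0 = id"
  by (simp add: shift_def fun_eq_iff)

lemma shift_add: "shift (j + k) = shift j \<circ> shift k"
  by (simp add: shift_def fun_eq_iff algebra_simps)

definition orbit_closure :: "config \<Rightarrow> config set" where
  "orbit_closure x = closure (range (\<lambda>k. shift k x))"

definition subshift :: "config set \<Rightarrow> bool" where
  "subshift X \<longleftrightarrow> closed X \<and> shift 1 ` X = X"

definition hereditary :: "config set \<Rightarrow> bool" where
  "hereditary X \<longleftrightarrow> subshift X \<and> (\<forall>x\<in>X. \<forall>y. y \<le> x \<longrightarrow> y \<in> X)"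

definition invariant_measures :: "config set \<Rightarrow> config measure set" where
  "invariant_measures Y =
    {M. sets M = sets (restrict_space borel Y) \<and> prob_space M \<and> distr M M (shift 1) = M}"

text \<open>
  The weak topology: the coarsest one making \<open>M \<mapsto> \<integral>f dM\<close> continuous for every continuous
  real function on \<open>Y\<close>. Only closed, hence compact, \<open>Y\<close> are of interest, so the test functions
  need not be required to be bounded.
\<close>

definition weak_topology :: "config set \<Rightarrow> config measure topology" where
  "weak_topology Y = topology_generated_by
    {{M \<in> invariant_measures Y. (\<integral>x. f x \<partial>M) \<in> U} | (f :: config \<Rightarrow> real) U.
      continuous_on Y f \<and> open U}"

lemma topspace_weak_topology: "topspace (weak_topology Y) = invariant_measures Y"
proof -
  have "{M \<in> invariant_measures Y. (\<integral>x. (0::real) \<partial>M) \<in> UNIV} \<in>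
    {{M \<in> invariant_measures Y. (\<integral>x. f x \<partial>M) \<in> U} | (f :: config \<Rightarrow> real) U.
      continuous_on Y f \<and> open U}"
    using continuous_on_const[of Y "0::real"] open_UNIV by blast
  then show ?thesis
    unfolding weak_topology_def topology_generated_by_topspace by auto
qed

text \<open>
  Measures do not form a type of class \<open>real_vector\<close>, so \<open>extreme_point_of\<close> is unavailable; convex
  combinations are spelled out on measurable sets.
\<close>

definition extreme_measures :: "'a measure set \<Rightarrow> 'a measure set" where
  "extreme_measures P =
    {M \<in> P. \<forall>M1\<in>P. \<forall>M2\<in>P. \<forall>t::real. 0 < t \<and> t < 1 \<and>
       (\<forall>A\<in>sets M. measure M A = t * measure M1 A + (1 - t) * measure M2 A)
       \<longrightarrow> M1 = M \<and> M2 = M}"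

text \<open>
  Only used for the invariant measures of a subshift, which always form a Choquet simplex; hence no
  simplex condition appears here.
\<close>

definition poulsen :: "'a measure topology \<Rightarrow> bool" where
  "poulsen T \<longleftrightarrow>
    (\<exists>M\<in>topspace T. \<exists>N\<in>topspace T. M \<noteq> N) \<and>
    T closure_of extreme_measures (topspace T) = topspace T"

end

theory Submission
  imports Defs "HOL-Real_Asymp.Real_Asymp" "HOL-Number_Theory.Cong"
begin

text \<open>The \<open>B\<close>-free set is sieved from \<open>\<int>\<close>, and light tails say that it is approximated in density by the
  periodic sets sieved by the finitely many \<open>b < K\<close>. Everything is derived from this approximation and
  from the Chinese remainder theorem.

  \<^emph>\<open>Heredity.\<close> It suffices to find, for a window of \<open>\<eta>\<close> and any choice of ones in it, another window in
  which exactly these ones are switched off (\<open>thinned_window_occurs\<close>). The infinite coprime subset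
  supplies for each such position a private modulus whose primes exceed the length of the window, and
  the Chinese remainder theorem moves the window to a place where these moduli divide. The difficulty
  is not to lose the other ones, because the progression one moves along is much sparser than the tail
  chosen before it. The estimate \<open>progression_divisors_density\<close> overcomes this: along the
  progression, the divisors below a late cutoff act like reduced moduli that are prime to its modulus
  and thus do not notice it.

  \<^emph>\<open>Extreme measures.\<close> Let \<open>w\<close> be a periodic 0-1-sequence. Sending a profinite integer \<open>h\<close> to the
  sequence that is \<open>w\<close> at \<open>h\<close>, masked by the condition that no \<open>b \<in> B\<close> divides \<open>h + i\<close>, maps Haar measure to a
  shift-invariant measure, and for \<open>w = 1\<close> this is the Mirsky measure. By heredity it lives on the orbit closure
  (\<open>AE_sieve_map_in_orbit_closure\<close>). It is extreme since the odometer \<open>h \<mapsto> h + 1\<close> is uniquely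
  ergodic: an invariant measure with a density with respect to it lifts to an invariant measure on the
  profinite integers, that is, to Haar measure (\<open>odometer_factor_rigid\<close>).

  \<^emph>\<open>Density.\<close> Given any invariant \<open>M\<close>, fix \<open>K\<close> with a small tail. All points of the orbit closure lie
  below translates of the periodic set sieved by \<open>b < K\<close>, so long words sampled from \<open>M\<close> can be concatenated,
  in phase with this set, to a periodic \<open>w\<close> below it with the window statistics of \<open>M\<close>
  (\<open>periodic_model\<close>). Masking \<open>w\<close> by the remaining \<open>b \<ge> K\<close> changes these statistics by at most the
  density of a tail times the length of the window (\<open>haar_sieve_window_error\<close>), and gives an extreme measure close to \<open>M\<close>. The simplex has more than one
  point since the positive density of the \<open>B\<close>-free set distinguishes a large mask from the empty one.\<close>

section \<open>Upper density\<close>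

lemma upper_density_le_iff:
  assumes "e \<ge> 0"
  shows "upper_density F \<le> ereal e \<longleftrightarrow>
    (\<forall>d>0. \<forall>\<^sub>F N in sequentially. real (card (F \<inter> {1..int N})) \<le> (e + d) * real N)"
proof -
  have "upper_density F \<le> ereal e \<longleftrightarrow> (\<forall>y>ereal e. \<forall>\<^sub>F N in sequentially. ereal (real (card (F \<inter> {1..int N})) / real N) < y)"
    unfolding upper_density_def by (rule Limsup_le_iff)
  also have "\<dots> \<longleftrightarrow> (\<forall>d>0. \<forall>\<^sub>F N in sequentially. real (card (F \<inter> {1..int N})) \<le> (e + d) * real N)"
  proof safe
    fix d :: real
    assume *: "\<forall>y>ereal e. \<forall>\<^sub>F N in sequentially. ereal (real (card (F \<inter> {1..int N})) / real N) < y" and "d > 0"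
    then have "\<forall>\<^sub>F N in sequentially. ereal (real (card (F \<inter> {1..int N})) / real N) < ereal (e + d)"
      using *[rule_format, of "ereal (e + d)"] by simp
    then show "\<forall>\<^sub>F N in sequentially. real (card (F \<inter> {1..int N})) \<le> (e + d) * real N"
      using eventually_gt_at_top[of 0]
      by eventually_elim (simp add: divide_simps)
  next
    fix y :: ereal
    assume *: "\<forall>d>0. \<forall>\<^sub>F N in sequentially. real (card (F \<inter> {1..int N})) \<le> (e + d) * real N"
      and y: "ereal e < y"
    then obtain z where z: "ereal e < ereal z" "ereal z < y"
      using ereal_dense2 by blast
    have "\<forall>\<^sub>F N in sequentially. real (card (F \<inter> {1..int N})) \<le> (e + (z - e)) * real N"
      using *[rule_format, of "z - e"] z(1) unfolding less_ereal.simps by linarith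
    then show "\<forall>\<^sub>F N in sequentially. ereal (real (card (F \<inter> {1..int N})) / real N) < y"
      using eventually_gt_at_top[of 0]
    proof eventually_elim
      case (elim N)
      then have "real (card (F \<inter> {1..int N})) / real N \<le> z" by (simp add: divide_simps)
      then show ?case using z(2) by (meson ereal_less_eq(3) le_less_trans)
    qed
  qed
  finally show ?thesis .
qed

lemma upper_density_leD:
  assumes "upper_density F \<le> ereal e" "e \<ge> 0" "d > 0"
  shows "\<forall>\<^sub>F N in sequentially. real (card (F \<inter> {1..int N})) \<le> (e + d) * real N"
  using upper_density_le_iff assms by blast

lemma upper_density_nonneg: "0 \<le> upper_density F"
  unfolding upper_density_def
  by (rule le_Limsup) (auto intro!: always_eventually)

lemma upper_density_mono: "F \<subseteq> G \<Longrightarrow> upper_density F \<le> upper_density G"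
  unfolding upper_density_def
  by (intro Limsup_mono always_eventually allI)
     (auto intro!: divide_right_mono card_mono)

lemma upper_density_UN_le:
  assumes "finite I" "\<And>i. i \<in> I \<Longrightarrow> upper_density (F i) \<le> ereal (e i)" "\<And>i. i \<in> I \<Longrightarrow> e i \<ge> 0"
  shows "upper_density (\<Union>i\<in>I. F i) \<le> ereal (\<Sum>i\<in>I. e i)"
proof -
  have "\<forall>\<^sub>F N in sequentially. real (card ((\<Union>i\<in>I. F i) \<inter> {1..int N})) \<le> ((\<Sum>i\<in>I. e i) + d) * real N"
    if "d > 0" for d
  proof -
    define d' where "d' = d / (real (card I) + 1)"
    have d': "d' > 0" using that by (simp add: d'_def)
    have dle: "real (card I) * d' \<le> d" using that by (simp add: d'_def field_simps)
    have "\<forall>\<^sub>F N in sequentially. \<forall>i\<in>I. real (card (F i \<inter> {1..int N})) \<le> (e i + d') * real N"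
      using assms d' by (intro eventually_ball_finite) (auto intro!: upper_density_leD)
    then show ?thesis
    proof eventually_elim
      case (elim N)
      have "(\<Union>i\<in>I. F i) \<inter> {1..int N} = (\<Union>i\<in>I. F i \<inter> {1..int N})" by auto
      then have "real (card ((\<Union>i\<in>I. F i) \<inter> {1..int N})) \<le> real (\<Sum>i\<in>I. card (F i \<inter> {1..int N}))"
        using card_UN_le[OF assms(1)] by (metis of_nat_le_iff)
      also have "\<dots> \<le> (\<Sum>i\<in>I. (e i + d') * real N)"
        using elim by (auto intro!: sum_mono)
      also have "\<dots> = ((\<Sum>i\<in>I. e i) + real (card I) * d') * real N"
        by (simp add: sum.distrib sum_distrib_right[symmetric])
      also have "\<dots> \<le> ((\<Sum>i\<in>I. e i) + d) * real N"
        using dle by (intro mult_right_mono) auto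
      finally show ?case .
    qed
  qed
  then show ?thesis
    using assms by (subst upper_density_le_iff) (auto intro!: sum_nonneg)
qed

lemma upper_density_Un_le:
  assumes "upper_density F \<le> ereal a" "upper_density G \<le> ereal b" "a \<ge> 0" "b \<ge> 0"
  shows "upper_density (F \<union> G) \<le> ereal (a + b)"
proof -
  have "upper_density (\<Union>i\<in>UNIV. if i then F else G) \<le> ereal (\<Sum>i\<in>UNIV. if i then a else b)"
    using assms by (intro upper_density_UN_le) auto
  also have "(\<Union>i\<in>UNIV. if i then F else G) = F \<union> G" by auto
  also have "(\<Sum>i\<in>UNIV. if i then a else b) = a + b" by (simp add: UNIV_bool)
  finally show ?thesis .
qed

text \<open>The map \<open>t \<mapsto> a * t + c\<close> is injective and sends \<open>{1..N}\<close> into \<open>{1..a * N + \<bar>c\<bar>}\<close>, except for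
  at most \<open>2 * \<bar>c\<bar> + 1\<close> points, which land in \<open>{-\<bar>c\<bar>..\<bar>c\<bar>}\<close>; a bounded number of points does not
  influence the density.\<close>

lemma upper_density_affine_preimage:
  assumes "upper_density F \<le> ereal e" "e \<ge> 0" "a > 0"
  shows "upper_density {t. int a * t + c \<in> F} \<le> ereal (real a * e)"
proof -
  let ?c = "nat \<bar>c\<bar>"
  have "\<forall>\<^sub>F N in sequentially. real (card ({t. int a * t + c \<in> F} \<inter> {1..int N})) \<le> (real a * e + d) * real N"
    if "d > 0" for d
  proof -
    define d' where "d' = d / (2 * real a)"
    have d': "d' > 0" using that assms by (simp add: d'_def)
    have tend: "filterlim (\<lambda>N. a * N + ?c) sequentially sequentially"
      using assms(3)
      by (intro filterlim_at_top_mono[OF filterlim_ident] always_eventually allI)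
         (simp add: trans_le_add1)
    have "\<forall>\<^sub>F N in sequentially. real (card (F \<inter> {1..int (a * N + ?c)})) \<le> (e + d') * real (a * N + ?c)"
      using eventually_compose_filterlim[OF upper_density_leD[OF assms(1,2) d'] tend] .
    moreover have "\<forall>\<^sub>F N in sequentially. (2 * real ?c + 1) + (e + d') * real ?c \<le> (d/2) * real N"
      using that by real_asymp
    ultimately show ?thesis
    proof eventually_elim
      case (elim N)
      let ?f = "\<lambda>t. int a * t + c"
      let ?S = "{t. ?f t \<in> F} \<inter> {1..int N}"
      have "inj_on ?f ?S" using assms(3) by (auto simp: inj_on_def)
      then have "card ?S = card (?f ` ?S)" by (simp add: card_image)
      also have "\<dots> \<le> card ((F \<inter> {1..int (a * N + ?c)}) \<union> {- int ?c..int ?c})"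
      proof (rule card_mono)
        show "?f ` ?S \<subseteq> (F \<inter> {1..int (a * N + ?c)}) \<union> {- int ?c..int ?c}"
        proof safe
          fix t assume t: "int a * t + c \<in> F" "t \<in> {1..int N}" "int a * t + c \<notin> {- int ?c..int ?c}"
          have "int a * t > 0" "int a * t \<le> int a * int N" using t assms(3) by auto
          with t(3) show "int a * t + c \<in> {1..int (a * N + ?c)}" by auto
        qed
      qed auto
      also have "\<dots> \<le> card (F \<inter> {1..int (a * N + ?c)}) + card {- int ?c..int ?c}" by (rule card_Un_le)
      finally have "real (card ?S) \<le> real (card (F \<inter> {1..int (a * N + ?c)})) + (2 * real ?c + 1)"
        by simp
      also have "\<dots> \<le> (e + d') * real (a * N + ?c) + (2 * real ?c + 1)" using elim by simp
      also have "\<dots> = (real a * e + d/2) * real N + ((2 * real ?c + 1) + (e + d') * real ?c)"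
        using assms(3) by (simp add: d'_def field_simps)
      also have "\<dots> \<le> (real a * e + d/2) * real N + (d/2) * real N" using elim by linarith
      finally show ?case by (simp add: algebra_simps)
    qed
  qed
  then show ?thesis using assms by (subst upper_density_le_iff) auto
qed

lemma upper_density_translate:
  assumes "upper_density F \<le> ereal e" "e \<ge> 0"
  shows "upper_density {t. t + c \<in> F} \<le> ereal e"
  using upper_density_affine_preimage[OF assms, of 1 c] by simp

text \<open>Sieving by finitely many moduli leaves a periodic set, whose density is a finite count and obeys the
  Chinese remainder theorem. Every density that is needed exactly, rather than bounded, is that of a
  periodic set.\<close>

definition periodic :: "nat \<Rightarrow> int set \<Rightarrow> bool" where
  "periodic N E \<longleftrightarrow> N > 0 \<and> (\<forall>m. m + int N \<in> E \<longleftrightarrow> m \<in> E)"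

definition freq :: "nat \<Rightarrow> int set \<Rightarrow> real" where
  "freq N E = real (card (E \<inter> {0..<int N})) / real N"

lemma periodic_mult:
  assumes "periodic N E"
  shows "m + int N * k \<in> E \<longleftrightarrow> m \<in> E"
proof (induction k arbitrary: m rule: int_induct[where k = 0])
  case (step1 i)
  have "m + int N * (i + 1) = (m + int N * i) + int N" by (simp add: algebra_simps)
  then show ?case using step1 assms by (metis periodic_def)
next
  case (step2 i)
  have "m + int N * i = (m + int N * (i - 1)) + int N" by (simp add: algebra_simps)
  then show ?case using step2 assms by (metis periodic_def)
qed simp

lemma periodic_mod:
  assumes "periodic N E"
  shows "m mod int N \<in> E \<longleftrightarrow> m \<in> E"
  using periodic_mult[OF assms, of "m mod int N" "m div int N"] by simp

lemma periodic_cong: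
  assumes "periodic N E" "[m = n] (mod int N)"
  shows "m \<in> E \<longleftrightarrow> n \<in> E"
  using periodic_mod[OF assms(1)] assms(2) unfolding cong_def by metis

lemma card_periodic_multiple:
  assumes "periodic N E"
  shows "card (E \<inter> {1..int (N * k)}) = k * card (E \<inter> {0..<int N})"
proof (induction k)
  case (Suc k)
  have N: "N > 0" using assms by (simp add: periodic_def)
  have *: "E \<inter> {1..int (N * Suc k)} = (E \<inter> {1..int (N * k)}) \<union> (E \<inter> {int (N * k) + 1..int (N * k) + int N})"
  proof -
    define a where "a = int (N * k)"
    have "int (N * Suc k) = a + int N" "a \<ge> 0" by (simp_all add: a_def algebra_simps)
    moreover have "E \<inter> {1..a + int N} = (E \<inter> {1..a}) \<union> (E \<inter> {a + 1..a + int N})"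
      using \<open>a \<ge> 0\<close> by auto
    ultimately show ?thesis by (simp only: a_def)
  qed
  have "bij_betw (\<lambda>m. m mod int N) (E \<inter> {int (N * k) + 1..int (N * k) + int N}) (E \<inter> {0..<int N})"
  proof (rule bij_betwI')
    fix x y assume x: "x \<in> E \<inter> {int (N * k) + 1..int (N * k) + int N}" and y: "y \<in> E \<inter> {int (N * k) + 1..int (N * k) + int N}"
    show "(x mod int N = y mod int N) = (x = y)"
    proof
      assume "x mod int N = y mod int N"
      then have "int N dvd x - y" by (simp add: mod_eq_dvd_iff)
      moreover have "\<bar>x - y\<bar> < int N" using x y by auto
      ultimately show "x = y" using dvd_imp_le_int[of "x - y" "int N"] by auto
    qed simp
  next
    fix x assume "x \<in> E \<inter> {int (N * k) + 1..int (N * k) + int N}"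
    then show "x mod int N \<in> E \<inter> {0..<int N}" using N periodic_mod[OF assms] by auto
  next
    fix y assume y: "y \<in> E \<inter> {0..<int N}"
    show "\<exists>x\<in>E \<inter> {int (N * k) + 1..int (N * k) + int N}. y = x mod int N"
    proof (cases "y = 0")
      case True
      then have "int (N * k) + int N \<in> E \<inter> {int (N * k) + 1..int (N * k) + int N}"
        using y N periodic_mult[OF assms, of y "int k + 1"] by (auto simp: algebra_simps)
      then show ?thesis using True by (intro bexI[of _ "int (N * k) + int N"]) auto
    next
      case False
      then have "y + int N * int k \<in> E \<inter> {int (N * k) + 1..int (N * k) + int N}"
        using y N periodic_mult[OF assms, of y "int k"] by auto
      then show ?thesis using y by (intro bexI[of _ "y + int N * int k"]) auto
    qed
  qed
  then have "card (E \<inter> {int (N * k) + 1..int (N * k) + int N}) = card (E \<inter> {0..<int N})"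
    by (rule bij_betw_same_card)
  moreover have "card (E \<inter> {1..int (N * Suc k)}) = card (E \<inter> {1..int (N * k)}) + card (E \<inter> {int (N * k) + 1..int (N * k) + int N})"
    unfolding * by (rule card_Un_disjoint) auto
  ultimately show ?case using Suc by simp
qed simp

lemma freq_nonneg: "freq N E \<ge> 0" by (simp add: freq_def)

lemma upper_density_periodic:
  assumes "periodic N E"
  shows "upper_density E = ereal (freq N E)"
proof (rule antisym)
  have N: "N > 0" using assms by (simp add: periodic_def)
  show "upper_density E \<le> ereal (freq N E)"
  proof (subst upper_density_le_iff[OF freq_nonneg], safe)
    fix d :: real assume d: "d > 0"
    have "\<forall>\<^sub>F n in sequentially. real N \<le> d * real n" using d by real_asymp
    then show "\<forall>\<^sub>F n in sequentially. real (card (E \<inter> {1..int n})) \<le> (freq N E + d) * real n"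
    proof eventually_elim
      case (elim n)
      let ?k = "n div N"
      have "E \<inter> {1..int n} \<subseteq> (E \<inter> {1..int (N * ?k)}) \<union> {int (N * ?k) + 1..int n}" by auto
      then have "card (E \<inter> {1..int n}) \<le> card ((E \<inter> {1..int (N * ?k)}) \<union> {int (N * ?k) + 1..int n})"
        by (intro card_mono) auto
      also have "\<dots> \<le> card (E \<inter> {1..int (N * ?k)}) + card {int (N * ?k) + 1..int n}" by (rule card_Un_le)
      also have "card {int (N * ?k) + 1..int n} = n mod N"
        by (simp add: minus_mult_div_eq_mod nat_diff_distrib' of_nat_diff flip: of_nat_mult)
      also have "card (E \<inter> {1..int (N * ?k)}) = ?k * card (E \<inter> {0..<int N})"
        by (rule card_periodic_multiple[OF assms])
      finally have "real (card (E \<inter> {1..int n})) \<le> real (?k * card (E \<inter> {0..<int N}) + n mod N)"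
        by (simp only: of_nat_le_iff)
      also have "\<dots> = real ?k * real (card (E \<inter> {0..<int N})) + real (n mod N)"
        by (simp only: of_nat_add of_nat_mult)
      also have "\<dots> \<le> freq N E * real n + real N"
      proof (rule add_mono)
        have "real ?k * real N = real (?k * N)" by (simp only: of_nat_mult)
        also have "\<dots> \<le> real n" by (simp only: of_nat_le_iff div_times_less_eq_dividend)
        finally have "freq N E * (real ?k * real N) \<le> freq N E * real n"
          using freq_nonneg by (rule mult_left_mono)
        moreover have "freq N E * (real ?k * real N) = real ?k * real (card (E \<inter> {0..<int N}))"
          using N unfolding freq_def by (metis mult.commute mult.left_commute nonzero_eq_divide_eq of_nat_0_less_iff order_less_irrefl)
        ultimately show "real ?k * real (card (E \<inter> {0..<int N})) \<le> freq N E * real n" by (simp only:)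
        show "real (n mod N) \<le> real N" unfolding of_nat_le_iff using mod_less_divisor[OF N] by (rule less_imp_le)
      qed
      also have "\<dots> \<le> (freq N E + d) * real n" using elim by (simp add: algebra_simps)
      finally show ?case .
    qed
  qed
next
  have N: "N > 0" using assms by (simp add: periodic_def)
  show "ereal (freq N E) \<le> upper_density E"
  proof (rule ccontr)
    assume "\<not> ereal (freq N E) \<le> upper_density E"
    then obtain z where z: "upper_density E < ereal z" "ereal z < ereal (freq N E)"
      using ereal_dense2 unfolding not_le by blast
    have z0: "z \<ge> 0"
      using order.strict_trans1[OF upper_density_nonneg z(1)] by simp
    define d where "d = (freq N E - z) / 2"
    have d: "d > 0" "z + d < freq N E" using z(2) by (simp_all add: d_def field_simps)
    have "\<forall>\<^sub>F n in sequentially. real (card (E \<inter> {1..int n})) \<le> (z + d) * real n"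
      using upper_density_leD[OF less_imp_le[OF z(1)] z0 d(1)] .
    then obtain n0 where n0: "\<And>n. n \<ge> n0 \<Longrightarrow> real (card (E \<inter> {1..int n})) \<le> (z + d) * real n"
      unfolding eventually_sequentially by blast
    define k where "k = n0 + 1"
    have "k \<le> N * k" using N by simp
    then have k: "N * k \<ge> n0" "N * k > 0" unfolding k_def by linarith+
    have "real (card (E \<inter> {1..int (N * k)})) = freq N E * real (N * k)"
      using N unfolding card_periodic_multiple[OF assms] freq_def by (simp add: field_simps)
    then have "freq N E * real (N * k) \<le> (z + d) * real (N * k)" using n0[OF k(1)] by (simp only:)
    then have "freq N E \<le> z + d" using k(2) by (simp only: mult_le_cancel_right_pos of_nat_0_less_iff)
    then show False using d(2) by simp
  qed
qed

lemma periodic_Int: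
  assumes "periodic N E" "periodic N F"
  shows "periodic N (E \<inter> F)"
  using assms by (simp add: periodic_def)

lemma periodic_dvd:
  assumes "periodic N E" "N dvd N'" "N' > 0"
  shows "periodic N' E"
  using assms periodic_mult[OF assms(1)] unfolding periodic_def by (auto elim!: dvdE)

lemma periodic_window:
  assumes "periodic N {m. w m}"
  shows "periodic N {m. P (\<lambda>i. w (m + i))}"
proof -
  have "w (m + int N + i) = w (m + i)" for m i
    using assms unfolding periodic_def by (metis add.assoc add.commute mem_Collect_eq)
  then show ?thesis using assms by (simp add: periodic_def)
qed

lemma freq_multiple:
  assumes "periodic N E" "N dvd N'" "N' > 0"
  shows "freq N' E = freq N E"
  using upper_density_periodic[OF assms(1)] upper_density_periodic[OF periodic_dvd[OF assms]]
  by simp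

text \<open>An affine map with coefficient prime to the period permutes the residues, hence preserves the
  frequency of a periodic set.\<close>

lemma freq_affine_coprime:
  assumes "periodic N E" "coprime a (int N)"
  shows "freq N {t. a * t + c \<in> E} = freq N E" "periodic N {t. a * t + c \<in> E}"
proof -
  have N: "N > 0" using assms by (simp add: periodic_def)
  obtain a' where a': "[a * a' = 1] (mod int N)" using cong_solve_coprime_int[OF assms(2)] by blast
  let ?f = "\<lambda>t. (a * t + c) mod int N"
  have "bij_betw ?f ({t. a * t + c \<in> E} \<inter> {0..<int N}) (E \<inter> {0..<int N})"
  proof (rule bij_betwI')
    fix x y assume x: "x \<in> {t. a * t + c \<in> E} \<inter> {0..<int N}" and y: "y \<in> {t. a * t + c \<in> E} \<inter> {0..<int N}"
    show "(?f x = ?f y) = (x = y)"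
    proof
      assume "?f x = ?f y"
      then have "[a * x + c = a * y + c] (mod int N)" by (simp add: cong_def)
      then have "[a * x = a * y] (mod int N)" by (rule cong_add_rcancel[THEN iffD1])
      then have "[x = y] (mod int N)" using assms(2) cong_mult_lcancel by blast
      then show "x = y" using x y by (simp add: cong_def)
    qed simp
  next
    fix x assume "x \<in> {t. a * t + c \<in> E} \<inter> {0..<int N}"
    then show "?f x \<in> E \<inter> {0..<int N}" using N periodic_mod[OF assms(1)] by auto
  next
    fix y assume y: "y \<in> E \<inter> {0..<int N}"
    let ?x = "(a' * (y - c)) mod int N"
    have "[a * ?x + c = a * (a' * (y - c)) + c] (mod int N)"
      by (intro cong_add cong_mult cong_mod_left) auto
    also have "a * (a' * (y - c)) + c = (a * a') * (y - c) + c" by simp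
    also have "[\<dots> = 1 * (y - c) + c] (mod int N)" by (intro cong_add cong_mult a') auto
    also have "1 * (y - c) + c = y" by simp
    finally have *: "[a * ?x + c = y] (mod int N)" .
    then have "?x \<in> {t. a * t + c \<in> E} \<inter> {0..<int N}" using y N periodic_cong[OF assms(1) *] by auto
    moreover have "y = ?f ?x" using * y by (simp add: cong_def)
    ultimately show "\<exists>x\<in>{t. a * t + c \<in> E} \<inter> {0..<int N}. y = ?f x" by blast
  qed
  then show "freq N {t. a * t + c \<in> E} = freq N E"
    unfolding freq_def by (simp add: bij_betw_same_card)
  have "a * (m + int N) + c \<in> E \<longleftrightarrow> a * m + c \<in> E" for m
    using periodic_mult[OF assms(1), of "a * m + c" a] by (simp add: algebra_simps)
  then show "periodic N {t. a * t + c \<in> E}" using N by (simp add: periodic_def)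
qed

section \<open>Orbit closures\<close>

lemma coordinate_open:
  fixes F :: "int set"
  assumes "finite F"
  shows "open {x::config. \<forall>i\<in>F. x i = y i}"
proof -
  have "open ((\<lambda>x::config. x i) -` {y i})" for i
    by (intro open_vimage continuous_on_product_coordinates) (simp add: discrete_topology_class.open_discrete)
  then have "open (\<Inter>i\<in>F. (\<lambda>x::config. x i) -` {y i})"
    using assms by (intro open_INT) auto
  also have "(\<Inter>i\<in>F. (\<lambda>x::config. x i) -` {y i}) = {x. \<forall>i\<in>F. x i = y i}" by auto
  finally show ?thesis .
qed

lemma open_contains_window:
  fixes U :: "config set"
  assumes "open U" "x \<in> U"
  obtains n where "n \<ge> 0" "\<And>y. (\<forall>i\<in>{-n..n}. y i = x i) \<Longrightarrow> y \<in> U"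
proof -
  have "openin (product_topology (\<lambda>i::int. euclidean :: bool topology) UNIV) U"
    using assms(1) unfolding open_fun_def .
  from product_topology_open_contains_basis[OF this assms(2)] obtain X where
    X: "x \<in> Pi\<^sub>E UNIV X" "finite {i. X i \<noteq> UNIV}" "Pi\<^sub>E UNIV X \<subseteq> U" by auto
  define n where "n = Max (abs ` insert 0 {i. X i \<noteq> UNIV})"
  have fin: "finite (abs ` insert 0 {i. X i \<noteq> UNIV})" using X(2) by simp
  have n: "\<bar>i\<bar> \<le> n" if "i = 0 \<or> X i \<noteq> UNIV" for i
    unfolding n_def using that fin by (intro Max_ge) auto
  show ?thesis
  proof
    show "n \<ge> 0" using n[of 0] by simp
    fix y assume y: "\<forall>i\<in>{-n..n}. y i = x i"
    have "y i \<in> X i" for i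
    proof (cases "X i = UNIV")
      case False
      then have "i \<in> {-n..n}" using n[of i] by auto
      then have "y i = x i" using y by blast
      then show ?thesis using X(1) by auto
    qed simp
    then show "y \<in> U" using X(3) by auto
  qed
qed

lemma orbit_closure_iff:
  "x \<in> orbit_closure e \<longleftrightarrow> (\<forall>n. \<exists>k. \<forall>i\<in>{-n..n}. x i = e (i + k))"
proof
  assume x: "x \<in> orbit_closure e"
  show "\<forall>n. \<exists>k. \<forall>i\<in>{-n..n}. x i = e (i + k)"
  proof
    fix n :: int
    have "open {z::config. \<forall>i\<in>{-n..n}. z i = x i}" by (rule coordinate_open) simp
    then have "range (\<lambda>k. shift k e) \<inter> {z::config. \<forall>i\<in>{-n..n}. z i = x i} \<noteq> {}"
      using x unfolding orbit_closure_def by (subst (asm) closure_iff_nhds_not_empty) blast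
    then obtain k where "\<forall>i\<in>{-n..n}. shift k e i = x i" by blast
    then show "\<exists>k. \<forall>i\<in>{-n..n}. x i = e (i + k)" by (auto simp: shift_def)
  qed
next
  assume *: "\<forall>n. \<exists>k. \<forall>i\<in>{-n..n}. x i = e (i + k)"
  show "x \<in> orbit_closure e"
    unfolding orbit_closure_def closure_iff_nhds_not_empty
  proof (intro allI impI)
    fix A U assume U: "U \<subseteq> A" "open U" "x \<in> U"
    obtain n where n: "n \<ge> 0" "\<And>y. (\<forall>i\<in>{-n..n}. y i = x i) \<Longrightarrow> y \<in> U"
      using open_contains_window[OF U(2,3)] by blast
    obtain k where "\<forall>i\<in>{-n..n}. x i = e (i + k)" using * by blast
    then have "shift k e \<in> U" by (intro n) (auto simp: shift_def)
    then show "range (\<lambda>k. shift k e) \<inter> A \<noteq> {}" using U(1) by blast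
  qed
qed

lemma shift_in_orbit_closure:
  assumes "x \<in> orbit_closure e"
  shows "shift j x \<in> orbit_closure e"
  unfolding orbit_closure_iff
proof
  fix n :: int
  obtain k where k: "\<forall>i\<in>{-(n + \<bar>j\<bar>)..n + \<bar>j\<bar>}. x i = e (i + k)"
    using assms unfolding orbit_closure_iff by blast
  have "shift j x i = e (i + (j + k))" if "i \<in> {-n..n}" for i
  proof -
    have "i + j \<in> {-(n + \<bar>j\<bar>)..n + \<bar>j\<bar>}" using that by auto
    from k[rule_format, OF this] show ?thesis by (simp only: shift_def add.assoc)
  qed
  then show "\<exists>k. \<forall>i\<in>{-n..n}. shift j x i = e (i + k)" by blast
qed

lemma subshift_orbit_closure: "subshift (orbit_closure e)"
  unfolding subshift_def
proof
  show "closed (orbit_closure e)" by (simp add: orbit_closure_def)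
  have "x \<in> shift 1 ` orbit_closure e" if "x \<in> orbit_closure e" for x
  proof
    show "x = shift 1 (shift (- 1) x)" by (simp add: shift_def)
    show "shift (- 1) x \<in> orbit_closure e" by (rule shift_in_orbit_closure[OF that])
  qed
  then show "shift 1 ` orbit_closure e = orbit_closure e"
    using shift_in_orbit_closure by blast
qed

section \<open>Light tails\<close>

text \<open>The sets whose upper density is assumed to vanish as \<open>K\<close> grows: they measure how far the
  sieve by all of \<open>B\<close> is from the periodic sieve by the members below \<open>K\<close>.\<close>

definition tail :: "nat set \<Rightarrow> nat \<Rightarrow> int set" where
  "tail B K = (\<Union>b\<in>{b\<in>B. b \<ge> K}. multiples b)"

lemma mem_tail: "m \<in> tail B K \<longleftrightarrow> (\<exists>b\<in>B. b \<ge> K \<and> int b dvd m)"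
  by (auto simp: tail_def multiples_def dvd_def)

lemma eta_iff: "eta B m \<longleftrightarrow> (\<forall>b\<in>B. \<not> int b dvd m)"
  by (auto simp: eta_def free_set_def multiples_def dvd_def)

lemma light_tails_eventually:
  assumes "(\<lambda>K. upper_density (tail B K)) \<longlonglongrightarrow> 0" "e > 0"
  shows "\<forall>\<^sub>F K in sequentially. upper_density (tail B K) \<le> ereal e"
  using order_tendstoD(2)[OF assms(1), of "ereal e"] assms(2)
  by (auto elim!: eventually_mono)

lemma upper_density_less_one_gap:
  assumes "upper_density F < 1"
  shows "\<exists>t. t \<notin> F"
proof (rule ccontr)
  assume "\<nexists>t. t \<notin> F"
  then have "F = UNIV" by auto
  moreover have "upper_density UNIV = ereal (freq 1 UNIV)"
    by (rule upper_density_periodic) (simp add: periodic_def)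
  ultimately show False using assms by (simp add: freq_def)
qed

section \<open>Heredity\<close>

text \<open>This is where light tails give an estimate inside an arithmetic progression that is uniform in its
  modulus \<open>M * c\<close>. The naive bound for the points of the progression that have a divisor in \<open>B\<close> is
  \<open>M * c\<close> times the density of a tail, and it is useless as long as the tail has been chosen before
  the modulus. It is used only for the divisors from \<open>K\<close> on, where \<open>K\<close> may depend on \<open>M\<close> and \<open>c\<close>.

  For \<open>b < K\<close> prime to \<open>c\<close> one uses that \<open>v\<close> itself is free. Since \<open>M\<close> is so divisible, the points of the
  progression are \<open>v * q\<close> with \<open>q\<close> prime to all numbers up to \<open>y\<close>; hence \<open>b\<close> divides \<open>v * q\<close> only if
  the reduced number \<open>b div gcd b \<bar>v\<bar>\<close> divides \<open>q\<close>, and this reduced number is prime to \<open>M * c\<close> and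
  differs from \<open>1\<close>, which forces \<open>b > y\<close>. For moduli prime to \<open>M * c\<close> the progression
  looks like the whole of \<open>\<int>\<close>, and there, multiples of the reduced numbers become points of the tail
  beyond \<open>y\<close> after multiplication by \<open>\<bar>v\<bar>\<close>. This costs only the factor \<open>\<bar>v\<bar>\<close>, which is known
  before \<open>y\<close> is chosen.\<close>

lemma progression_divisors_density:
  fixes v :: int and M c y K :: nat
  assumes B0: "0 \<notin> B" and free: "\<forall>b\<in>B. \<not> int b dvd v" and v: "v \<noteq> 0" "\<bar>v\<bar> \<le> int y"
    and M: "M = fact y * fact y" and c: "coprime c M" "c > 0"
    and e: "upper_density (tail B (Suc y)) \<le> ereal e" "e \<ge> 0"
    and e': "upper_density (tail B K) \<le> ereal e'" "e' \<ge> 0"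
  shows "upper_density {t. \<exists>b\<in>B. coprime b c \<and> int b dvd v + int M * (r + int c * t)}
    \<le> ereal (real_of_int \<bar>v\<bar> * e + real (M * c) * e')"
proof -
  define V where "V = nat \<bar>v\<bar>"
  have V: "V > 0" "int V = \<bar>v\<bar>" using v by (auto simp: V_def)
  have Mc: "M * c > 0" using c by (simp add: M)
  define red where "red b = b div gcd b V" for b
  have red: "b = red b * gcd b V" for b by (simp add: red_def)
  define G where "G = red ` {b\<in>B. y < b \<and> b < K \<and> coprime (red b) (M * c)}"
  have finG: "finite G" by (auto simp: G_def)
  have Gpos: "g > 0" if g: "g \<in> G" for g
  proof -
    obtain b where b: "b \<in> B" "g = red b" using g unfolding G_def by blast
    then show ?thesis using B0 red[of b] by (cases "g = 0") auto
  qed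
  define R where "R = \<Prod>G"
  define E where "E = {u. \<exists>g\<in>G. int g dvd u}"
  have gR: "int g dvd int R" if "g \<in> G" for g
    unfolding R_def of_nat_dvd_iff by (rule dvd_prodI[OF finG that, of "\<lambda>x. x"])
  have perE: "periodic R E"
    unfolding periodic_def
  proof
    show "R > 0" unfolding R_def using Gpos by (simp add: prod_pos)
    show "\<forall>m. (m + int R \<in> E) = (m \<in> E)"
      using gR unfolding E_def by (auto simp: dvd_add_left_iff)
  qed
  have cop: "coprime (int (M * c)) (int R)"
    unfolding coprime_int_iff R_def by (rule prod_coprime_right) (auto simp: G_def coprime_commute)
  have "upper_density E \<le> upper_density {u. int V * u + 0 \<in> tail B (Suc y)}"
  proof (rule upper_density_mono, safe)
    fix u assume "u \<in> E"
    then obtain b where b: "b \<in> B" "y < b" "int (red b) dvd u" by (auto simp: E_def G_def)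
    have "int b dvd int V * u"
      using b(3) by (subst red[of b]) (simp add: mult.commute mult_dvd_mono)
    then show "int V * u + 0 \<in> tail B (Suc y)" 
      using b unfolding mem_tail by (intro bexI[of _ b]) simp_all
  qed
  also have "\<dots> \<le> ereal (real V * e)" by (rule upper_density_affine_preimage[OF e V(1)])
  finally have "freq R E \<le> real V * e" by (simp add: upper_density_periodic[OF perE])
  then have P: "upper_density {t. int (M * c) * t + (v + int M * r) \<in> E} \<le> ereal (real V * e)"
    using freq_affine_coprime[OF perE cop] by (metis ereal_less_eq(3) upper_density_periodic)
  have Q: "upper_density {t. int (M * c) * t + (v + int M * r) \<in> tail B K} \<le> ereal (real (M * c) * e')"
    by (rule upper_density_affine_preimage[OF e' Mc])
  have "upper_density {t. \<exists>b\<in>B. coprime b c \<and> int b dvd v + int M * (r + int c * t)} \<le>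
    upper_density ({t. int (M * c) * t + (v + int M * r) \<in> E} \<union> {t. int (M * c) * t + (v + int M * r) \<in> tail B K})"
  proof (rule upper_density_mono, rule subsetI)
    fix t assume "t \<in> {t. \<exists>b\<in>B. coprime b c \<and> int b dvd v + int M * (r + int c * t)}"
    then obtain b where b: "b \<in> B" "coprime b c" "int b dvd v + int M * (r + int c * t)" by blast
    have eq: "int (M * c) * t + (v + int M * r) = v + int M * (r + int c * t)" by (simp add: algebra_simps)
    show "t \<in> {t. int (M * c) * t + (v + int M * r) \<in> E} \<union> {t. int (M * c) * t + (v + int M * r) \<in> tail B K}"
    proof (cases "b < K")
      case False
      then show ?thesis using b unfolding mem_tail mem_Collect_eq Un_iff eq by auto
    next
      case True
      have "V dvd fact y" using V v by (intro dvd_fact) auto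
      then have "int V dvd fact y" by (metis of_nat_dvd_iff of_nat_fact)
      then have "v dvd fact y" using V by (metis abs_dvd_iff)
      then obtain w where w: "fact y = v * w" by (auto elim: dvdE)
      define q where "q = 1 + fact y * w * (r + int c * t)"
      have vq: "v + int M * (r + int c * t) = v * q"
        using w by (simp add: M q_def algebra_simps)
      have "coprime (fact y) q"
      proof (rule coprimeI)
        fix d :: int assume "d dvd fact y" "d dvd q"
        then show "is_unit d" unfolding q_def by (metis dvd_add_left_iff dvd_mult2)
      qed
      have rq: "int (red b) dvd q"
      proof -
        have bpos: "gcd b V > 0" using V by simp
        have "int b dvd int V * q" using b(3) vq V by (metis abs_dvd_iff abs_mult dvd_abs_iff abs_of_nat)
        then have "int (red b) * int (gcd b V) dvd int (V div gcd b V) * int (gcd b V) * q"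
          using red[of b] by (metis dvd_div_mult_self gcd_dvd2 of_nat_mult)
        then have "int (red b) dvd int (V div gcd b V) * q"
          using bpos V(1) by (simp add: mult.commute mult.left_commute)
        moreover have "coprime (red b) (V div gcd b V)"
          unfolding red_def using bpos by (intro div_gcd_coprime) auto
        ultimately show ?thesis by (simp add: coprime_dvd_mult_right_iff)
      qed
      have cy: "coprime (int (red b)) (fact y)"
        using \<open>coprime (fact y) q\<close> rq by (meson coprime_commute coprime_divisors dvd_refl)
      then have cy: "coprime (red b) (fact y)" by (metis coprime_int_iff of_nat_fact)
      have "red b dvd b" using red[of b] by (metis dvd_triv_left)
      then have "coprime (red b) c" using b(2) by (meson coprime_divisors dvd_refl)
      then have cop: "coprime (red b) (M * c)" using cy by (simp add: M)
      have "y < b"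
      proof (rule ccontr)
        assume "\<not> y < b"
        then have "b dvd fact y" using b B0 by (intro dvd_fact) (auto simp: Suc_le_eq intro: gr0I)
        then have "red b dvd fact y" using \<open>red b dvd b\<close> by (rule dvd_trans[rotated])
        then have "red b = 1" using cy by (metis coprime_common_divisor_nat dvd_refl)
        then have "b dvd V" using red[of b] by (metis gcd_dvd2 mult_1)
        then have "int b dvd v" using V by (metis dvd_abs_iff of_nat_dvd_iff)
        then show False using free b by blast
      qed
      then have "red b \<in> G" using b True cop by (auto simp: G_def)
      moreover have "int (red b) dvd v * q" using rq by simp
      ultimately show ?thesis unfolding E_def mem_Collect_eq Un_iff eq vq by blast
    qed
  qed
  also have "\<dots> \<le> ereal (real V * e + real (M * c) * e')"
    by (rule upper_density_Un_le[OF P Q]) (use e e' in auto)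
  also have "real V = real_of_int \<bar>v\<bar>" using V by (metis of_int_of_nat_eq)
  finally show ?thesis .
qed

lemma chinese_remainder_int:
  fixes m :: "'a \<Rightarrow> nat" and u :: "'a \<Rightarrow> int"
  assumes "finite A" "\<And>i. i \<in> A \<Longrightarrow> m i > 0"
    and "\<And>i j. i \<in> A \<Longrightarrow> j \<in> A \<Longrightarrow> i \<noteq> j \<Longrightarrow> coprime (m i) (m j)"
  shows "\<exists>x. \<forall>i\<in>A. [x = u i] (mod int (m i))"
proof -
  obtain x where x: "\<forall>i\<in>A. [x = nat (u i mod int (m i))] (mod m i)"
    using chinese_remainder_nat[OF assms(1), of m "\<lambda>i. nat (u i mod int (m i))"] assms(3) by blast
  have "[int x = u i] (mod int (m i))" if "i \<in> A" for i
  proof -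
    have "[int x = int (nat (u i mod int (m i)))] (mod int (m i))"
      unfolding cong_int_iff using x that by blast
    also have "int (nat (u i mod int (m i))) = u i mod int (m i)" using assms(2)[OF that] by simp
    also have "[u i mod int (m i) = u i] (mod int (m i))" by simp
    finally show ?thesis .
  qed
  then show ?thesis by blast
qed

text \<open>A prime divides at most one member of a pairwise coprime set. So the members that share a prime with
  \<open>N\<close> are told apart by such a prime, and there are finitely many of them.\<close>

lemma infinite_coprime_to:
  fixes C :: "nat set"
  assumes "infinite C" "pairwise coprime C" "N > 0"
  shows "infinite {c\<in>C. coprime c N}"
proof
  assume fin: "finite {c\<in>C. coprime c N}"
  have "\<exists>q. prime q \<and> q dvd c \<and> q dvd N" if "\<not> coprime c N" for c
  proof -
    have "gcd c N \<noteq> 1" using that by (simp add: coprime_iff_gcd_eq_1)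
    then obtain q where "prime q" "q dvd gcd c N" using prime_factor_nat by blast
    then show ?thesis by (meson dvd_trans gcd_dvd1 gcd_dvd2)
  qed
  then obtain p where p: "\<And>c. \<not> coprime c N \<Longrightarrow> prime (p c) \<and> p c dvd c \<and> p c dvd N" by metis
  have "inj_on p {c\<in>C. \<not> coprime c N}"
  proof (rule inj_onI, rule ccontr)
    fix c d assume *: "c \<in> {c\<in>C. \<not> coprime c N}" "d \<in> {c\<in>C. \<not> coprime c N}" "p c = p d" "c \<noteq> d"
    then have "coprime c d" using assms(2) by (auto simp: pairwise_def)
    moreover have "p c dvd c" "p c dvd d" "prime (p c)" using p[of c] p[of d] * by auto
    ultimately show False by (metis coprime_common_divisor_nat not_prime_1)
  qed
  moreover have "p ` {c\<in>C. \<not> coprime c N} \<subseteq> {d. d dvd N}" using p by auto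
  ultimately have "finite {c\<in>C. \<not> coprime c N}"
    using finite_divisors_nat[OF assms(3)] by (metis finite_imageD finite_subset)
  moreover have "C = {c\<in>C. coprime c N} \<union> {c\<in>C. \<not> coprime c N}" by auto
  ultimately show False using fin assms(1) by (metis finite_Un)
qed

text \<open>The combinatorial core of heredity: ones of \<open>\<eta>\<close> in the window at \<open>k\<close> can be switched off at will by
  moving to another window \<open>m\<close>. Positions that were zero stay zero because \<open>m\<close> is congruent to \<open>k\<close>
  modulo a number \<open>M\<close> that is divisible by one witness for each of them. A position \<open>i\<close> that is to be
  switched off gets its own modulus \<open>g i\<close> from the coprime family, and \<open>g i\<close> is made to divide
  \<open>i + m\<close>. The ones that are to be kept survive for most \<open>m\<close> of this kind: every \<open>b \<in> B\<close> dividing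
  \<open>j + m\<close> is prime to all \<open>g i\<close>, since a common prime would divide \<open>i - j\<close> but exceed the
  length of the window, so that the preceding density bound applies to each kept position.\<close>

lemma thinned_window_occurs:
  fixes u :: config and k n :: int
  assumes B0: "0 \<notin> B" and light: "(\<lambda>K. upper_density (tail B K)) \<longlonglongrightarrow> 0"
    and C: "C \<subseteq> B" "infinite C" "pairwise coprime C"
    and u: "\<And>i. i \<in> {-n..n} \<Longrightarrow> u i \<Longrightarrow> eta B (i + k)"
  shows "\<exists>m. \<forall>i\<in>{-n..n}. u i = eta B (i + m)"
proof -
  define A D Z where "A = {i\<in>{-n..n}. u i}" and "D = {i\<in>{-n..n}. \<not> u i \<and> eta B (i + k)}"
    and "Z = {i\<in>{-n..n}. \<not> eta B (i + k)}"
  have fin: "finite A" "finite D" "finite Z"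
    unfolding A_def D_def Z_def by (rule finite_subset[OF Collect_restrict], simp)+
  have "\<forall>i\<in>Z. \<exists>b. b \<in> B \<and> int b dvd i + k" unfolding Z_def eta_iff by blast
  then obtain f where f: "\<And>i. i \<in> Z \<Longrightarrow> f i \<in> B \<and> int (f i) dvd i + k" by metis
  define S where "S = (\<Sum>j\<in>A. real_of_int \<bar>j + k\<bar>)"
  have S: "S \<ge> 0" unfolding S_def by (intro sum_nonneg) auto
  \<comment> \<open>The kept positions lose density at most \<open>S * e\<close> to the divisors below a late cutoff,
    whatever the moduli chosen after \<open>y\<close>.\<close>
  define e where "e = 1 / (2 * (S + 1))"
  have e: "e > 0" "S * e \<le> 1/2" using S by (auto simp: e_def field_simps)
  have "\<forall>\<^sub>F y in sequentially. upper_density (tail B (Suc y)) \<le> ereal e"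
    using light_tails_eventually[OF light e(1)] by (subst eventually_sequentially_Suc)
  moreover have "\<forall>\<^sub>F y in sequentially. \<forall>i\<in>Z. f i \<le> y"
    using fin by (intro eventually_ball_finite ballI eventually_ge_at_top)
  moreover have "\<forall>\<^sub>F y in sequentially. nat (\<bar>k\<bar> + 2 * \<bar>n\<bar>) \<le> y" by (rule eventually_ge_at_top)
  ultimately have "\<forall>\<^sub>F y in sequentially. upper_density (tail B (Suc y)) \<le> ereal e \<and>
      (\<forall>i\<in>Z. f i \<le> y) \<and> nat (\<bar>k\<bar> + 2 * \<bar>n\<bar>) \<le> y"
    by (simp add: eventually_conj_iff)
  then obtain y where y: "upper_density (tail B (Suc y)) \<le> ereal e" "\<forall>i\<in>Z. f i \<le> y"
      "nat (\<bar>k\<bar> + 2 * \<bar>n\<bar>) \<le> y"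
    unfolding eventually_sequentially by blast
  \<comment> \<open>Squaring leaves a multiple of \<open>fact y\<close> after division by any \<open>j + k\<close>, as \<open>\<bar>j + k\<bar> \<le> y\<close>.\<close>
  define M :: nat where "M = fact y * fact y"
  have M: "M > 0" by (simp add: M_def)

  have "infinite {c\<in>C. coprime c M}" by (rule infinite_coprime_to[OF C(2,3) M])
  then obtain T where T: "T \<subseteq> {c\<in>C. coprime c M}" "finite T" "card T = card D"
    using infinite_arbitrarily_large by blast
  then obtain g where g: "bij_betw g D T" using fin finite_same_card_bij by metis
  have gT: "g i \<in> B" "g i \<in> C" "coprime (g i) M" if "i \<in> D" for i
    using bij_betwE[OF g] T(1) C(1) that by auto
  have gpos: "g i > 0" if "i \<in> D" for i using gT[OF that] B0 by (cases "g i = 0") auto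
  have gcop: "coprime (g i) (g j)" if "i \<in> D" "j \<in> D" "i \<noteq> j" for i j
    using C(3) gT that g unfolding pairwise_def by (metis bij_betw_inv_into_left)
  define c where "c = (\<Prod>i\<in>D. g i)"
  have cpos: "c > 0" unfolding c_def using gpos by (simp add: prod_pos)
  have cM: "coprime c M" unfolding c_def by (rule prod_coprime_left) (rule gT)
  have gc: "g i dvd c" if "i \<in> D" for i unfolding c_def using fin(2) that by (rule dvd_prodI)

  \<comment> \<open>The index \<open>None\<close> carries the congruence modulo \<open>M\<close>, the others those that switch off \<open>D\<close>.\<close>
  define I where "I = insert None (Some ` D)"
  define md where "md x = (case x of None \<Rightarrow> M | Some i \<Rightarrow> g i)" for x
  define rs where "rs x = (case x of None \<Rightarrow> k | Some i \<Rightarrow> - i)" for x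
  have "\<exists>x. \<forall>i\<in>I. [x = rs i] (mod int (md i))"
  proof (rule chinese_remainder_int)
    show "finite I" using fin by (simp add: I_def)
    show "md i > 0" if "i \<in> I" for i using that M gpos by (auto simp: I_def md_def)
    show "coprime (md i) (md j)" if "i \<in> I" "j \<in> I" "i \<noteq> j" for i j
      using that by (cases i; cases j)
        (auto simp: I_def md_def intro: gcop gT(3) gT(3)[THEN coprime_commute[THEN iffD1]])
  qed
  then obtain m0 where m0: "[m0 = k] (mod int M)" "\<And>i. i \<in> D \<Longrightarrow> [m0 = - i] (mod int (g i))"
    by (auto simp: I_def md_def rs_def)
  obtain r where r: "m0 = k + int M * r" using m0(1) by (metis cong_iff_lin cong_sym)

  \<comment> \<open>Only now, with all moduli fixed, is the remaining tail cut off.\<close>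
  define e' where "e' = 1 / (4 * (real (card A) + 1) * real (M * c))"
  have Mc: "real (M * c) > 0" using M cpos by simp
  have e': "e' > 0" unfolding e'_def using M cpos by simp
  have eq: "real (M * c) * e' = 1 / (4 * (real (card A) + 1))" unfolding e'_def using M cpos by simp
  have e'2: "real (card A) * (real (M * c) * e') \<le> 1/4" unfolding eq by (simp add: field_simps)
  obtain K where K: "upper_density (tail B K) \<le> ereal e'"
    using light_tails_eventually[OF light e'] unfolding eventually_sequentially by blast
  define Bad where "Bad j = {t. \<exists>b\<in>B. coprime b c \<and> int b dvd (j + k) + int M * (r + int c * t)}" for j
  have "upper_density (Bad j) \<le> ereal (real_of_int \<bar>j + k\<bar> * e + real (M * c) * e')" if j: "j \<in> A" for j
    unfolding Bad_def
  proof (rule progression_divisors_density[OF B0 _ _ _ M_def cM cpos y(1) _ K])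
    have eta: "eta B (j + k)" using u j by (auto simp: A_def)
    then show "\<forall>b\<in>B. \<not> int b dvd j + k" by (simp add: eta_iff)
    obtain b where "b \<in> B" using C by (metis finite.emptyI subset_eq ex_in_conv)
    then show "j + k \<noteq> 0" using eta by (auto simp: eta_iff)
    have "\<bar>j\<bar> \<le> n" using j by (auto simp: A_def)
    then show "\<bar>j + k\<bar> \<le> int y" using y(3) by linarith
  qed (use e e' in auto)
  then have "upper_density (\<Union>j\<in>A. Bad j) \<le> ereal (\<Sum>j\<in>A. real_of_int \<bar>j + k\<bar> * e + real (M * c) * e')"
    by (rule upper_density_UN_le[OF fin(1)]) (use e e' in auto)
  also have "(\<Sum>j\<in>A. real_of_int \<bar>j + k\<bar> * e + real (M * c) * e') = S * e + real (card A) * (real (M * c) * e')"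
    by (simp add: sum.distrib S_def sum_distrib_right)
  also have "ereal \<dots> < 1" using e(2) e'2 by simp
  finally obtain t where t: "t \<notin> (\<Union>j\<in>A. Bad j)" using upper_density_less_one_gap by blast

  define m where "m = k + int M * (r + int c * t)"
  have mg: "int (g i) dvd i + m" if "i \<in> D" for i
  proof -
    have "int (g i) dvd m0 - (- i)" using m0(2)[OF that] by (simp add: cong_iff_dvd_diff)
    moreover have "int (g i) dvd int M * int c * t" using gc[OF that] by (simp add: dvd_mult dvd_mult2)
    moreover have "i + m = (m0 - (- i)) + int M * int c * t" unfolding m_def r by (simp add: algebra_simps)
    ultimately show ?thesis by (metis dvd_add)
  qed
  have "u i = eta B (i + m)" if i: "i \<in> {-n..n}" for i
  proof -
    consider "i \<in> A" | "i \<in> D" | "i \<in> Z" using i by (auto simp: A_def D_def Z_def)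
    then show ?thesis
    proof cases
      case 1
      have "\<not> int b dvd i + m" if b: "b \<in> B" for b
      proof
        assume dv: "int b dvd i + m"
        have "coprime (g l) b" if l: "l \<in> D" for l
        proof (rule ccontr)
          assume "\<not> coprime (g l) b"
          then have "gcd (g l) b \<noteq> 1" by (simp add: coprime_iff_gcd_eq_1)
          then obtain p where p: "prime p" "p dvd gcd (g l) b" using prime_factor_nat by blast
          then have "int p dvd i + m" "int p dvd l + m"
            using dv mg[OF l] by (meson dvd_trans gcd_dvd1 gcd_dvd2 of_nat_dvd_iff)+
          then have "int p dvd i - l" using dvd_diff[of "int p" "i + m" "l + m"] by simp
          moreover have "i \<noteq> l" using 1 l by (auto simp: A_def D_def)
          ultimately have "int p \<le> \<bar>i - l\<bar>" using dvd_imp_le_int[of "i - l" "int p"] by simp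
          also have "\<bar>i - l\<bar> \<le> 2 * \<bar>n\<bar>" using i l by (auto simp: D_def)
          also have "\<dots> \<le> int y" using y(3) by linarith
          finally have "p \<le> y" by simp
          then have "p dvd fact y" using prime_ge_1_nat[OF p(1)] by (intro dvd_fact) auto
          then have "p dvd M" by (simp add: M_def)
          moreover have "p dvd g l" using p(2) by simp
          ultimately show False using gT(3)[OF l] p(1) by (metis coprime_common_divisor_nat not_prime_1)
        qed
        then have "coprime c b" unfolding c_def by (intro prod_coprime_left) auto
        then have "t \<in> Bad i" unfolding Bad_def using b dv
          by (auto simp: m_def coprime_commute add.assoc)
        then show False using t 1 by blast
      qed
      then show ?thesis using 1 by (simp add: A_def eta_iff)
    next
      case 2
      then show ?thesis using mg gT(1) by (auto simp: D_def eta_iff)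
    next
      case 3
      then have fi: "f i \<in> B" "int (f i) dvd i + k" "f i \<le> y" using f y(2) by auto
      then have "f i dvd fact y" using B0 by (intro dvd_fact) (auto simp: Suc_le_eq intro: gr0I)
      then have "f i dvd M" by (simp add: M_def)
      then have "int (f i) dvd int M * (r + int c * t)" by simp
      then have "int (f i) dvd i + m" using fi(2) unfolding m_def by (metis add.assoc dvd_add)
      then show ?thesis using 3 u[OF i] fi(1) by (auto simp: Z_def eta_iff)
    qed
  qed
  then show ?thesis by blast
qed

lemma hereditary_orbit_closure_eta:
  assumes "0 \<notin> B" "(\<lambda>K. upper_density (tail B K)) \<longlonglongrightarrow> 0"
    and "C \<subseteq> B" "infinite C" "pairwise coprime C"
  shows "hereditary (orbit_closure (eta B))"
  unfolding hereditary_def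
proof (intro conjI ballI allI impI)
  fix x y assume x: "x \<in> orbit_closure (eta B)" and yx: "y \<le> x"
  show "y \<in> orbit_closure (eta B)"
    unfolding orbit_closure_iff
  proof
    fix n :: int
    obtain k where "\<forall>i\<in>{-n..n}. x i = eta B (i + k)" using x unfolding orbit_closure_iff by blast
    then have "\<And>i. i \<in> {-n..n} \<Longrightarrow> y i \<Longrightarrow> eta B (i + k)" using yx by (auto simp: le_fun_def)
    then show "\<exists>k. \<forall>i\<in>{-n..n}. y i = eta B (i + k)"
      by (rule thinned_window_occurs[OF assms])
  qed
qed (rule subshift_orbit_closure)

section \<open>Haar measure on the profinite integers\<close>

text \<open>Second countability of the alphabet makes the Borel sets of the sequence space the product
  \<open>\<sigma>\<close>-algebra, so that measurability can be tested coordinate by coordinate.\<close>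

instance bool :: second_countable_topology
proof
  show "\<exists>B::bool set set. countable B \<and> open = generate_topology B"
  proof (intro exI conjI)
    show "countable (UNIV :: bool set set)" by (rule countable_finite) simp
    show "open = generate_topology (UNIV::bool set set)"
     by (auto simp: fun_eq_iff intro: generate_topology.Basis discrete_topology_class.open_discrete)
  qed
qed

text \<open>A profinite integer is recorded by its residues \<open>h N\<close> modulo \<open>fact N\<close>. Compatibility of the residues
  is imposed almost surely and not built into the space, which can then be a plain countable product.
  The predicate \<open>haar\<close> lists what is used about Haar measure; it determines the measure.\<close>

abbreviation residue_space :: "(nat \<Rightarrow> nat) measure" where
  "residue_space \<equiv> PiM UNIV (\<lambda>_. count_space UNIV)"

definition coherent :: "(nat \<Rightarrow> nat) \<Rightarrow> bool" where
  "coherent h \<longleftrightarrow> (\<forall>i j. i \<le> j \<longrightarrow> h i = h j mod fact i)"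

definition haar :: "(nat \<Rightarrow> nat) measure \<Rightarrow> bool" where
  "haar H \<longleftrightarrow> sets H = sets residue_space \<and> prob_space H \<and> (AE h in H. coherent h) \<and>
    (\<forall>N. \<forall>a<fact N. measure H {h. h N = a} = 1 / fact N)"

lemma haarD:
  assumes "haar H"
  shows "sets H = sets residue_space" "prob_space H" "AE h in H. coherent h" "space H = UNIV"
    "a < fact N \<Longrightarrow> measure H {h. h N = a} = 1 / fact N"
proof -
  show s: "sets H = sets residue_space" using assms by (simp add: haar_def)
  show "space H = UNIV" using sets_eq_imp_space_eq[OF s] by (simp add: space_PiM)
qed (use assms in \<open>auto simp: haar_def\<close>)

lemma coherent_less: "coherent h \<Longrightarrow> h N < fact N"
  unfolding coherent_def by (metis fact_gt_zero mod_less_divisor order_refl)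

text \<open>Divisibility by \<open>b\<close> can be read off the residue modulo \<open>fact b\<close>, and off every finer one. For this
  reason the sieve below consults the coordinate \<open>h b\<close> for each \<open>b\<close>.\<close>

lemma coherent_dvd_iff:
  assumes "coherent h" "b \<le> n" "b > 0"
  shows "int b dvd int (h b) + i \<longleftrightarrow> int b dvd int (h n) + i"
proof -
  have "b dvd fact b" using assms(3) by (intro dvd_fact) auto
  moreover have "h b = h n mod fact b" using assms unfolding coherent_def by blast
  ultimately have "h b mod b = h n mod b" by (simp add: mod_mod_cancel)
  then have "int (h b) mod int b = int (h n) mod int b" by (metis of_nat_mod)
  then have "(int (h b) + i) mod int b = (int (h n) + i) mod int b" by (rule mod_add_cong) simp
  then show ?thesis by (simp add: dvd_eq_mod_eq_0)
qed

lemma component_sets [measurable]: "(\<lambda>h. h N) \<in> measurable residue_space (count_space UNIV)"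
  by (rule measurable_component_singleton) simp

lemma residue_event_sets: "{h. P (h N)} \<in> sets residue_space" for P :: "nat \<Rightarrow> bool"
proof -
  have "{h \<in> space residue_space. P (h N)} \<in> sets residue_space" by measurable
  then show ?thesis by (simp add: space_PiM)
qed

lemma coherent_sets: "{h \<in> space residue_space. coherent h} \<in> sets residue_space"
  unfolding coherent_def by measurable

lemma haar_residue:
  assumes "haar H"
  shows "measure H {h. h N \<in> S} = real (card (S \<inter> {..<fact N})) / fact N"
proof -
  interpret prob_space H by (rule haarD[OF assms])
  have sets: "{h. P (h N)} \<in> sets H" for P :: "nat \<Rightarrow> bool"
    using residue_event_sets haarD(1)[OF assms] by simp
  have "AE h in H. h \<in> {h. h N \<in> S} \<longleftrightarrow> h \<in> (\<Union>a\<in>S \<inter> {..<fact N}. {h. h N = a})"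
    using haarD(3)[OF assms] by eventually_elim (auto dest: coherent_less[of _ N])
  then have "measure H {h. h N \<in> S} = measure H (\<Union>a\<in>S \<inter> {..<fact N}. {h. h N = a})"
    by (rule finite_measure_eq_AE) (auto intro!: sets sets.finite_UN)
  also have "\<dots> = (\<Sum>a\<in>S \<inter> {..<fact N}. measure H {h. h N = a})"
    by (rule finite_measure_finite_Union) (auto simp: disjoint_family_on_def intro: sets)
  also have "\<dots> = (\<Sum>a\<in>S \<inter> {..<fact N}. 1 / fact N)"
    by (rule sum.cong) (auto simp: haarD(5)[OF assms])
  finally show ?thesis by simp
qed

lemma haar_freq:
  assumes "haar H"
  shows "measure H {h. int (h N) \<in> E} = freq (fact N) E"
proof -
  have "card ({a. int a \<in> E} \<inter> {..<fact N}) = card (E \<inter> {0..<int (fact N)})"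
  proof (rule bij_betw_same_card[of int])
    show "bij_betw int ({a. int a \<in> E} \<inter> {..<fact N}) (E \<inter> {0..<int (fact N)})"
    proof (rule bij_betwI')
      fix y assume y: "y \<in> E \<inter> {0..<int (fact N)}"
      then have "y = int (nat y)" by simp
      moreover have "nat y < fact N" using y by (simp add: nat_less_iff del: of_nat_fact)
      ultimately show "\<exists>x\<in>{a. int a \<in> E} \<inter> {..<fact N}. y = int x" using y by (intro bexI[of _ "nat y"]) auto
    next
      fix x assume "x \<in> {a. int a \<in> E} \<inter> {..<fact N}"
      then show "int x \<in> E \<inter> {0..<int (fact N)}" by (simp del: of_nat_fact)
    qed simp
  qed
  then show ?thesis using haar_residue[OF assms, of N "{a. int a \<in> E}"] by (simp add: freq_def)
qed

text \<open>An event about finitely many coordinates is, by compatibility, an event about a single one of large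
  index, whose distribution is prescribed; such events generate the \<open>\<sigma>\<close>-algebra.\<close>

lemma haar_unique:
  assumes "haar H" "haar H'"
  shows "H = H'"
proof -
  interpret H: prob_space H by (rule haarD[OF assms(1)])
  have emb: "emeasure K (prod_emb UNIV (\<lambda>_. count_space UNIV) J (Pi\<^sub>E J A))
      = ennreal (real (card ({a. \<forall>i\<in>J. a mod fact i \<in> A i} \<inter> {..<fact N})) / fact N)"
    if K: "haar K" and J: "finite J" "\<And>i. i \<in> J \<Longrightarrow> i \<le> N" for K J N and A :: "nat \<Rightarrow> nat set"
  proof -
    interpret K: prob_space K by (rule haarD[OF K])
    have eq: "prod_emb UNIV (\<lambda>_. count_space UNIV) J (Pi\<^sub>E J A) = {h. \<forall>i\<in>J. h i \<in> A i}"
      by (auto simp: prod_emb_def PiE_iff extensional_def restrict_def)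
    have "{h \<in> space residue_space. \<forall>i\<in>J. h i \<in> A i} \<in> sets residue_space"
      using J(1) by measurable
    then have s: "{h. \<forall>i\<in>J. h i \<in> A i} \<in> sets K" using haarD(1)[OF K] by (simp add: space_PiM)
    have "AE h in K. h \<in> {h. \<forall>i\<in>J. h i \<in> A i} \<longleftrightarrow> h \<in> {h. h N \<in> {a. \<forall>i\<in>J. a mod fact i \<in> A i}}"
      using haarD(3)[OF K]
    proof eventually_elim
      case (elim h)
      have "h i = h N mod fact i" if "i \<in> J" for i
        using elim J(2)[OF that] unfolding coherent_def by blast
      then show ?case by simp
    qed
    then have "measure K {h. \<forall>i\<in>J. h i \<in> A i} = measure K {h. h N \<in> {a. \<forall>i\<in>J. a mod fact i \<in> A i}}"
      by (rule K.finite_measure_eq_AE)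
        (use s residue_event_sets haarD(1)[OF K] in auto)
    then show ?thesis unfolding eq K.emeasure_eq_measure haar_residue[OF K] by simp
  qed
  show ?thesis
  proof (rule measure_eqI_PiM_infinite)
    fix A :: "nat \<Rightarrow> nat set" and J :: "nat set" assume J: "finite J"
    then obtain N where "\<And>i. i \<in> J \<Longrightarrow> i \<le> N" by (meson finite_nat_set_iff_bounded_le)
    from emb[OF assms(1) J this] emb[OF assms(2) J this]
    show "emeasure H (prod_emb UNIV (\<lambda>_. count_space UNIV) J (Pi\<^sub>E J A)) =
      emeasure H' (prod_emb UNIV (\<lambda>_. count_space UNIV) J (Pi\<^sub>E J A))" by simp
  qed (use haarD assms in \<open>auto intro: H.finite_measure_axioms\<close>)
qed

text \<open>Digits in the factorial number system. Independent digits, the \<open>i\<close>-th one uniform on \<open>{0..i}\<close>, have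
  partial sums \<open>\<Sum>i<N. d i * fact i\<close> that are uniform modulo \<open>fact N\<close> and compatible, and this
  constructs Haar measure.\<close>

definition digit :: "nat \<Rightarrow> nat \<Rightarrow> nat" where
  "digit a i = (a mod fact (Suc i)) div fact i"

lemma digit_le: "digit a i \<le> i"
proof -
  have "a mod fact (Suc i) < Suc i * fact i" using mod_less_divisor[of "fact (Suc i)" a] by simp
  then have "digit a i < Suc i" unfolding digit_def by (rule less_mult_imp_div_less)
  then show ?thesis by simp
qed

lemma sum_digits: "(\<Sum>i<N. digit a i * fact i) = a mod fact N"
proof (induction N)
  case (Suc N)
  have "a mod fact (Suc N) = (a mod fact (Suc N)) div fact N * fact N + (a mod fact (Suc N)) mod fact N"
    by simp
  also have "(a mod fact (Suc N)) mod fact N = a mod fact N" by (rule mod_mod_cancel) (simp add: fact_dvd)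
  finally show ?case using Suc by (simp add: digit_def)
qed simp

lemma sum_digits_less:
  assumes "\<And>i. d i \<le> i"
  shows "(\<Sum>i<N. d i * fact i) < (fact N :: nat)"
proof (induction N)
  case (Suc N)
  have "d N * fact N \<le> N * fact N" using assms by (intro mult_right_mono) auto
  moreover have "fact (Suc N) = fact N + N * fact N" by simp
  ultimately show ?case using Suc unfolding sum.lessThan_Suc by linarith
qed simp

lemma sum_digits_mod:
  assumes "\<And>i. d i \<le> i" "m \<le> n"
  shows "(\<Sum>i<n. d i * fact i) mod fact m = (\<Sum>i<m. d i * fact i :: nat)"
  using assms(2)
proof (induction n rule: dec_induct)
  case base
  then show ?case using sum_digits_less[OF assms(1)] by simp
next
  case (step n)
  have "fact m dvd d n * fact n" using step by (simp add: fact_dvd dvd_mult)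
  then show ?case using step by (simp add: mod_add_right_eq[symmetric] mod_0_imp_dvd dvd_imp_mod_0)
qed

lemma haar_exists: "\<exists>H. haar H"
proof -
  define M where "M i = measure_pmf (pmf_of_set {0..i::nat})" for i
  interpret product_prob_space M UNIV
    by (rule product_prob_spaceI) (simp add: M_def prob_space_measure_pmf)
  have setsM: "sets (PiM UNIV M) = sets residue_space" by (rule sets_PiM_cong) (auto simp: M_def)
  have spaceM: "space (PiM UNIV M) = UNIV" by (simp add: space_PiM M_def)
  define R where "R d N = (\<Sum>i<N. d i * fact i)" for d :: "nat \<Rightarrow> nat" and N
  have Rm: "R \<in> measurable (PiM UNIV M) residue_space"
    unfolding measurable_cong_sets[OF setsM refl]
  proof (rule measurable_PiM_single')
    fix N
    have "(\<lambda>d. d i * fact i) \<in> measurable residue_space (borel :: nat measure)" for i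
      using measurable_compose[OF component_sets, of "\<lambda>x. x * fact i" borel i] by simp
    then have "(\<lambda>d. R d N) \<in> measurable residue_space borel"
      unfolding R_def by (rule borel_measurable_sum)
    then show "(\<lambda>d. R d N) \<in> measurable residue_space (count_space UNIV)"
      unfolding measurable_cong_sets[OF refl sets_borel_eq_count_space] .
  qed (auto simp: space_PiM)
  have ae: "AE d in PiM UNIV M. \<forall>i. d i \<le> i"
  proof (subst AE_all_countable, intro allI)
    fix i
    have "AE x in M i. x \<le> i" unfolding M_def AE_measure_pmf_iff by simp
    then show "AE d in PiM UNIV M. d i \<le> i" by (rule AE_component[rotated]) simp
  qed
  have digits: "(R d N = a) \<longleftrightarrow> (\<forall>i<N. d i = digit a i)" if d: "\<forall>i. d i \<le> i" and a: "a < fact N" for d N a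
  proof
    assume R: "R d N = a"
    show "\<forall>i<N. d i = digit a i"
    proof (intro allI impI)
      fix i assume "i < N"
      then have "a mod fact (Suc i) = R d (Suc i)"
        using sum_digits_mod[of d "Suc i" N] d R unfolding R_def by auto
      also have "\<dots> = d i * fact i + R d i" by (simp add: R_def)
      finally show "d i = digit a i"
        using sum_digits_less[of d i] d unfolding digit_def R_def by simp
    qed
  next
    assume "\<forall>i<N. d i = digit a i"
    then have "R d N = (\<Sum>i<N. digit a i * fact i)" by (simp add: R_def)
    then show "R d N = a" using a by (simp add: sum_digits)
  qed
  have "haar (distr (PiM UNIV M) residue_space R)"
    unfolding haar_def
  proof (intro conjI allI impI)
    show "prob_space (distr (PiM UNIV M) residue_space R)"
      by (rule prob_space_distr[OF Rm])
    show "AE h in distr (PiM UNIV M) residue_space R. coherent h"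
      unfolding AE_distr_iff[OF Rm coherent_sets]
      using ae
    proof eventually_elim
      case (elim d)
      then show ?case using sum_digits_mod[of d] unfolding coherent_def R_def by metis
    qed
    fix N a :: nat assume a: "a < fact N"
    have "measure (distr (PiM UNIV M) residue_space R) {h. h N = a} = measure (PiM UNIV M) (R -` {h. h N = a} \<inter> space (PiM UNIV M))"
      by (rule measure_distr[OF Rm residue_event_sets])
    also have "\<dots> = measure (PiM UNIV M) (prod_emb UNIV M {..<N} (Pi\<^sub>E {..<N} (\<lambda>i. {digit a i})))"
    proof (rule finite_measure_eq_AE)
      show "AE d in PiM UNIV M. d \<in> R -` {h. h N = a} \<inter> space (PiM UNIV M) \<longleftrightarrow>
        d \<in> prod_emb UNIV M {..<N} (Pi\<^sub>E {..<N} (\<lambda>i. {digit a i}))"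
        using ae by eventually_elim (use digits[OF _ a] in \<open>auto simp: spaceM prod_emb_def PiE_iff extensional_def restrict_def M_def\<close>)
      show "R -` {h. h N = a} \<inter> space (PiM UNIV M) \<in> sets (PiM UNIV M)"
        by (rule measurable_sets[OF Rm residue_event_sets])
    qed (auto simp: M_def intro!: sets_PiM_I)
    also have "\<dots> = (\<Prod>i<N. measure (M i) {digit a i})"
      by (rule measure_PiM_emb) (auto simp: M_def)
    also have "\<dots> = (\<Prod>i<N. 1 / real (Suc i))"
      by (rule prod.cong) (auto simp: M_def measure_pmf_single digit_le)
    also have "\<dots> = 1 / fact N"
      by (induction N) auto
    finally show "measure (distr (PiM UNIV M) residue_space R) {h. h N = a} = 1 / fact N" .
  qed simp
  then show ?thesis by blast
qed

text \<open>Adding \<open>1\<close> in the profinite integers.\<close>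

definition odometer :: "(nat \<Rightarrow> nat) \<Rightarrow> nat \<Rightarrow> nat" where
  "odometer h = (\<lambda>j. (h j + 1) mod fact j)"

lemma measurable_odometer: "odometer \<in> measurable residue_space residue_space"
  unfolding odometer_def by (rule measurable_PiM_single') (auto simp: space_PiM)

lemma coherent_odometer: "coherent h \<Longrightarrow> coherent (odometer h)"
  unfolding coherent_def odometer_def by (metis fact_dvd mod_add_left_eq mod_mod_cancel)

lemma mod_Suc_eq_Suc_iff:
  fixes x a F :: nat
  assumes "x < F" "Suc a < F"
  shows "(x + 1) mod F = Suc a \<longleftrightarrow> x = a"
  using assms by (cases "x + 1 = F") auto

text \<open>The odometer permutes the residues modulo \<open>fact N\<close> in a single cycle, so an invariant law gives all
  of them the same weight. Together with \<open>haar_unique\<close> this is the unique ergodicity of the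
  odometer.\<close>

lemma haar_of_invariant:
  assumes sets: "sets H = sets residue_space" and "prob_space H" and coh: "AE h in H. coherent h"
    and inv: "distr H residue_space odometer = H"
  shows "haar H"
proof -
  interpret prob_space H by fact
  have odo: "odometer \<in> measurable H residue_space"
    using measurable_odometer measurable_cong_sets[OF sets refl] by blast
  have sp: "space H = UNIV" using sets_eq_imp_space_eq[OF sets] by (simp add: space_PiM)
  have ev: "{h. P (h N)} \<in> sets H" for P N unfolding sets by (rule residue_event_sets)
  have step: "measure H {h. h N = Suc a} = measure H {h. h N = a}" if a: "Suc a < fact N" for N a
  proof -
    have "measure H {h. h N = Suc a} = measure (distr H residue_space odometer) {h. h N = Suc a}"
      by (simp add: inv)
    also have "\<dots> = measure H (odometer -` {h. h N = Suc a} \<inter> space H)"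
      by (rule measure_distr[OF odo residue_event_sets])
    also have "\<dots> = measure H {h. h N = a}"
    proof (rule finite_measure_eq_AE)
      show "AE h in H. h \<in> odometer -` {h. h N = Suc a} \<inter> space H \<longleftrightarrow> h \<in> {h. h N = a}"
        using coh
      proof eventually_elim
        case (elim h)
        then show ?case
          using mod_Suc_eq_Suc_iff[OF coherent_less a, of h] by (simp add: odometer_def sp)
      qed
    qed (rule measurable_sets[OF odo residue_event_sets] ev)+
    finally show ?thesis .
  qed
  have const: "measure H {h. h N = a} = measure H {h. h N = 0}" if "a < fact N" for N a
    using that by (induction a) (auto simp: step)
  have "measure H {h. h N = a} = 1 / fact N" if a: "a < fact N" for N a
  proof -
    have "AE h in H. h \<in> (\<Union>x<fact N. {h. h N = x})"
      using coh by eventually_elim (auto simp: coherent_less)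
    then have "measure H (\<Union>x<fact N. {h. h N = x}) = 1"
      by (subst prob_eq_1) (auto intro!: ev sets.finite_UN)
    then have "1 = measure H (\<Union>x<fact N. {h. h N = x})" by (rule sym)
    also have "\<dots> = (\<Sum>x<fact N. measure H {h. h N = x})"
      by (rule finite_measure_finite_Union) (auto simp: disjoint_family_on_def intro: ev)
    also have "\<dots> = (\<Sum>x<(fact N :: nat). measure H {h. h N = a})"
    proof (rule sum.cong)
      fix x assume "x \<in> {..<fact N :: nat}"
      then have x: "x < fact N" by simp
      show "measure H {h. h N = x} = measure H {h. h N = a}"
        by (rule trans[OF const[OF x] const[OF a, symmetric]])
    qed simp
    finally show ?thesis by (simp add: field_simps)
  qed
  then show ?thesis using assms by (simp add: haar_def)
qed

lemma haar_invariant: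
  assumes "haar H"
  shows "distr H residue_space odometer = H"
proof (rule haar_unique[OF _ assms])
  interpret prob_space H by (rule haarD[OF assms])
  note sets = haarD(1)[OF assms]
  have odo: "odometer \<in> measurable H residue_space"
    using measurable_odometer measurable_cong_sets[OF sets refl] by blast
  show "haar (distr H residue_space odometer)"
    unfolding haar_def
  proof (intro conjI allI impI)
    show "prob_space (distr H residue_space odometer)" by (rule prob_space_distr[OF odo])
    show "AE h in distr H residue_space odometer. coherent h"
      unfolding AE_distr_iff[OF odo coherent_sets]
      using haarD(3)[OF assms] by eventually_elim (rule coherent_odometer)
    fix N a :: nat assume a: "a < fact N"
    have F: "fact N > (0::nat)" by simp
    have "{x. (x + 1) mod fact N = a} \<inter> {..<fact N} = {if a = 0 then fact N - 1 else a - 1}"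
    proof (rule set_eqI)
      fix x
      show "x \<in> {x. (x + 1) mod fact N = a} \<inter> {..<fact N} \<longleftrightarrow> x \<in> {if a = 0 then fact N - 1 else a - 1}"
        using a F by (cases a; cases "x + 1 = fact N"; cases "x + 1 < fact N") auto
    qed
    moreover have "measure (distr H residue_space odometer) {h. h N = a} = measure H (odometer -` {h. h N = a} \<inter> space H)"
      by (rule measure_distr[OF odo residue_event_sets])
    moreover have "odometer -` {h. h N = a} \<inter> space H = {h. h N \<in> {x. (x + 1) mod fact N = a}}"
      by (auto simp: odometer_def haarD(4)[OF assms])
    ultimately show "measure (distr H residue_space odometer) {h. h N = a} = 1 / fact N"
      using haar_residue[OF assms, of N "{x. (x + 1) mod fact N = a}"] by simp
  qed simp
qed

text \<open>The coding that turns a profinite integer \<open>h\<close> into a configuration: the \<open>B\<close>-free set seen from \<open>h\<close>,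
  intersected with a periodic mask \<open>w\<close> of period \<open>fact N\<close>. At an ordinary integer \<open>h = m\<close> it is
  the translate by \<open>m\<close> of \<open>w\<close> masked by \<open>\<eta>\<close>.\<close>

definition sieve_map :: "nat set \<Rightarrow> config \<Rightarrow> nat \<Rightarrow> (nat \<Rightarrow> nat) \<Rightarrow> config" where
  "sieve_map B w N h = (\<lambda>i. w (int (h N) + i) \<and> (\<forall>b\<in>B. \<not> int b dvd int (h b) + i))"

lemma measurable_into_config:
  assumes "\<And>i. {x \<in> space M. f x i} \<in> sets M"
  shows "f \<in> measurable M (borel :: config measure)"
proof -
  have "(\<lambda>x. f x) \<in> measurable M (PiM UNIV (\<lambda>_. borel :: bool measure))"
  proof (rule measurable_PiM_single')
    fix i
    have "Measurable.pred M (\<lambda>x. f x i)" using assms by (simp add: pred_def)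
    then show "(\<lambda>x. f x i) \<in> measurable M borel"
      unfolding measurable_cong_sets[OF refl sets_borel_eq_count_space] .
  qed (auto simp: space_borel)
  then show ?thesis unfolding measurable_cong_sets[OF refl sets_PiM_equal_borel] .
qed

lemma measurable_sieve_map: "sieve_map B w N \<in> measurable residue_space borel"
proof (rule measurable_into_config)
  fix i
  show "{h \<in> space residue_space. sieve_map B w N h i} \<in> sets residue_space"
    unfolding sieve_map_def by measurable
qed

lemma sieve_map_odometer:
  assumes "periodic (fact N) {m. w m}" "0 \<notin> B"
  shows "sieve_map B w N (odometer h) = shift 1 (sieve_map B w N h)"
proof (rule ext)
  fix i
  have "[int (odometer h N) = int (h N) + 1] (mod int (fact N))"
    by (simp add: odometer_def cong_def zmod_int add.commute del: of_nat_fact)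
  then have "[int (odometer h N) + i = int (h N) + 1 + i] (mod int (fact N))" by (rule cong_add) simp
  then have "[int (odometer h N) + i = int (h N) + (i + 1)] (mod int (fact N))"
    by (simp only: add.assoc add.commute[of 1 i])
  then have w: "w (int (odometer h N) + i) = w (int (h N) + (i + 1))"
    using periodic_cong[OF assms(1)] by simp
  have d: "int b dvd int (odometer h b) + i \<longleftrightarrow> int b dvd int (h b) + (i + 1)" if "b \<in> B" for b
  proof -
    have "b dvd fact b" using that assms(2) by (intro dvd_fact) (auto simp: Suc_le_eq intro: gr0I)
    then have "[odometer h b = h b + 1] (mod b)" by (simp add: odometer_def cong_def mod_mod_cancel)
    then have "[int (odometer h b) = int (h b) + 1] (mod int b)" by (metis cong_int_iff of_nat_1 of_nat_add)
    then have "[int (odometer h b) + i = int (h b) + 1 + i] (mod int b)" by (rule cong_add) simp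
    then show ?thesis by (simp add: cong_dvd_iff algebra_simps)
  qed
  show "sieve_map B w N (odometer h) i = shift 1 (sieve_map B w N h) i"
    unfolding sieve_map_def shift_def using w d by auto
qed

lemma eta_periodic:
  assumes "0 \<notin> B"
  shows "periodic (fact K) {m. eta {b\<in>B. b < K} m}"
  unfolding periodic_def
proof (intro conjI allI)
  fix m
  have "int b dvd m + int (fact K) \<longleftrightarrow> int b dvd m" if "b \<in> B" "b < K" for b
  proof -
    have "b dvd fact K" using that assms by (intro dvd_fact) (auto simp: Suc_le_eq intro: gr0I)
    then have "int b dvd int (fact K)" by (simp only: of_nat_dvd_iff)
    then show ?thesis by (rule dvd_add_left_iff)
  qed
  then show "(m + int (fact K) \<in> {m. eta {b\<in>B. b < K} m}) = (m \<in> {m. eta {b\<in>B. b < K} m})"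
    by (auto simp: eta_iff)
qed simp

text \<open>If the mask already respects the divisors below \<open>K\<close>, the coded symbol differs from the mask only when
  some \<open>b \<ge> K\<close> divides \<open>h + i\<close>. For finitely many such \<open>b\<close> the probability is the density of a
  periodic subset of the tail; the bound passes to the increasing union.\<close>

lemma haar_sieve_error:
  assumes H: "haar H" and B0: "0 \<notin> B" and w: "\<And>m. w m \<Longrightarrow> eta {b\<in>B. b < K} m" and "K \<le> N"
    and e: "upper_density (tail B K) \<le> ereal e" "e \<ge> 0"
  shows "measure H {h. sieve_map B w N h i \<noteq> w (int (h N) + i)} \<le> e"
proof -
  interpret prob_space H by (rule haarD[OF H])
  note sets = haarD(1)[OF H]
  define S where "S n = {h. \<exists>b\<in>B. K \<le> b \<and> b \<le> n \<and> int b dvd int (h b) + i}" for n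
  have Ssets: "S n \<in> events" for n
  proof -
    have "{h \<in> space residue_space. \<exists>b\<in>B. K \<le> b \<and> b \<le> n \<and> int b dvd int (h b) + i} \<in> sets residue_space"
      by measurable
    then show ?thesis by (simp add: S_def sets space_PiM)
  qed
  have Sle: "prob (S n) \<le> e" for n
  proof -
    define E where "E = {m. \<exists>b\<in>B. K \<le> b \<and> b \<le> n \<and> int b dvd m + i}"
    have per: "periodic (fact n) E"
      unfolding periodic_def
    proof (intro conjI allI)
      fix m
      have "int b dvd m + int (fact n) + i \<longleftrightarrow> int b dvd m + i" if "b \<in> B" "b \<le> n" for b
      proof -
        have "b dvd fact n" using that B0 by (intro dvd_fact) (auto simp: Suc_le_eq intro: gr0I)
        then have "int b dvd int (fact n)" by (simp only: of_nat_dvd_iff)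
        then have "int b dvd (m + i) + int (fact n) \<longleftrightarrow> int b dvd m + i" by (rule dvd_add_left_iff)
        then show ?thesis by (simp only: add.assoc add.commute add.left_commute)
      qed
      then show "(m + int (fact n) \<in> E) = (m \<in> E)" unfolding E_def by blast
    qed simp
    have "upper_density E \<le> upper_density {m. m + i \<in> tail B K}"
      by (rule upper_density_mono) (auto simp: E_def mem_tail)
    also have "\<dots> \<le> ereal e" by (rule upper_density_translate[OF e])
    finally have "freq (fact n) E \<le> e" by (simp add: upper_density_periodic[OF per])
    moreover have "prob (S n) = prob {h. int (h n) \<in> E}"
    proof (rule finite_measure_eq_AE)
      show "AE h in H. h \<in> S n \<longleftrightarrow> h \<in> {h. int (h n) \<in> E}"
        using haarD(3)[OF H]
      proof eventually_elim
        case (elim h)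
        have "int b dvd int (h b) + i \<longleftrightarrow> int b dvd int (h n) + i" if "b \<in> B" "b \<le> n" for b
          using coherent_dvd_iff[OF elim that(2)] that B0 by (cases "b = 0") auto
        then show ?case unfolding S_def E_def by blast
      qed
      show "{h. int (h n) \<in> E} \<in> events" unfolding sets by (rule residue_event_sets)
    qed (rule Ssets)
    ultimately show ?thesis using haar_freq[OF H] by simp
  qed
  have "(\<lambda>n. prob (S n)) \<longlonglongrightarrow> prob (\<Union>n. S n)"
    by (rule finite_Lim_measure_incseq) (use Ssets in \<open>auto simp: incseq_def S_def\<close>)
  then have "prob (\<Union>n. S n) \<le> e" by (rule LIMSEQ_le_const2) (use Sle in blast)
  moreover have "prob {h. sieve_map B w N h i \<noteq> w (int (h N) + i)} \<le> prob (\<Union>n. S n)"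
  proof (rule finite_measure_mono_AE)
    show "AE h in H. h \<in> {h. sieve_map B w N h i \<noteq> w (int (h N) + i)} \<longrightarrow> h \<in> (\<Union>n. S n)"
      using haarD(3)[OF H]
    proof (eventually_elim, intro impI)
      fix h assume h: "coherent h" and ne: "h \<in> {h. sieve_map B w N h i \<noteq> w (int (h N) + i)}"
      then obtain b where b: "w (int (h N) + i)" "b \<in> B" "int b dvd int (h b) + i"
        unfolding sieve_map_def by blast
      have "K \<le> b"
      proof (rule ccontr)
        assume "\<not> K \<le> b"
        then have "int b dvd int (h N) + i"
          using coherent_dvd_iff[OF h, of b N] b B0 \<open>K \<le> N\<close> by (cases "b = 0") auto
        then show False using w[OF b(1)] b(2) \<open>\<not> K \<le> b\<close> by (auto simp: eta_iff)
      qed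
      then show "h \<in> (\<Union>n. S n)" using b unfolding S_def by blast
    qed
  qed (use Ssets in auto)
  ultimately show ?thesis by simp
qed

section \<open>Factors of the odometer\<close>

definition cylinder :: "int \<Rightarrow> config \<Rightarrow> config set" where
  "cylinder n u = {x. \<forall>i\<in>{-n..n}. x i = u i}"

lemma open_cylinder: "open (cylinder n u)"
  unfolding cylinder_def by (rule coordinate_open) simp

lemma cylinder_sets: "cylinder n u \<in> sets borel"
  using open_cylinder by simp

lemma measurable_shift: "shift k \<in> measurable borel borel"
proof (rule measurable_into_config)
  fix i
  have "open {x::config. \<forall>j\<in>{i + k}. x j = True}" by (rule coordinate_open) simp
  then show "{x \<in> space borel. shift k x i} \<in> sets borel" by (auto simp: shift_def)
qed

lemma subshift_shift:
  assumes "subshift X"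
  shows "x \<in> X \<Longrightarrow> shift 1 x \<in> X" "x \<in> X \<Longrightarrow> shift (- 1) x \<in> X"
proof -
  have X: "shift 1 ` X = X" using assms by (simp add: subshift_def)
  show "shift 1 x \<in> X" if x: "x \<in> X" using X x by blast
  show "shift (- 1) x \<in> X" if x: "x \<in> X"
  proof -
    obtain y where y: "y \<in> X" "x = shift 1 y" using X x by blast
    then have "shift (- 1) x = y" by (simp add: shift_def)
    then show ?thesis using y by simp
  qed
qed

lemma measurable_shift_subshift:
  assumes "subshift X"
  shows "shift 1 \<in> measurable (restrict_space borel X) (restrict_space borel X)"
    "shift (- 1) \<in> measurable (restrict_space borel X) (restrict_space borel X)"
  using subshift_shift[OF assms]
  by (auto intro!: measurable_restrict_space3 measurable_shift)

lemma invariant_measuresD: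
  assumes "M \<in> invariant_measures X"
  shows "sets M = sets (restrict_space borel X)" "prob_space M" "distr M M (shift 1) = M" "space M = X"
proof -
  show s: "sets M = sets (restrict_space borel X)" using assms by (simp add: invariant_measures_def)
  show "space M = X" using sets_eq_imp_space_eq[OF s] by (simp add: space_restrict_space)
qed (use assms in \<open>auto simp: invariant_measures_def\<close>)

lemma odometer_factor_invariant:
  assumes X: "subshift X" and H: "haar H" and phi: "\<phi> \<in> measurable H (restrict_space borel X)"
    and equiv: "AE h in H. \<phi> (odometer h) = shift 1 (\<phi> h)"
  shows "distr H (restrict_space borel X) \<phi> \<in> invariant_measures X"
proof -
  interpret prob_space H by (rule haarD[OF H])
  let ?R = "restrict_space borel X"
  let ?M = "distr H ?R \<phi>"
  note S = measurable_shift_subshift[OF X]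
  have odo: "odometer \<in> measurable H residue_space"
    using measurable_odometer measurable_cong_sets[OF haarD(1)[OF H] refl] by blast
  have phi': "\<phi> \<in> measurable residue_space ?R"
    using phi measurable_cong_sets[OF haarD(1)[OF H] refl] by blast
  have "distr ?M ?M (shift 1) = distr ?M ?R (shift 1)" by (rule distr_cong) auto
  also have "\<dots> = distr H ?R (shift 1 \<circ> \<phi>)" by (rule distr_distr[OF S(1) phi])
  also have "\<dots> = distr H ?R (\<phi> \<circ> odometer)"
  proof (rule distr_cong_AE)
    show "AE h in H. (shift 1 \<circ> \<phi>) h = (\<phi> \<circ> odometer) h" using equiv by eventually_elim simp
  qed (use measurable_comp[OF phi S(1)] measurable_comp[OF odo phi'] in auto)
  also have "\<dots> = distr (distr H residue_space odometer) ?R \<phi>"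
    by (rule distr_distr[OF phi' odo, symmetric])
  also have "distr H residue_space odometer = H" by (rule haar_invariant[OF H])
  finally show ?thesis
    unfolding invariant_measures_def using prob_space_distr[OF phi] by simp
qed

text \<open>Write \<open>f\<close> for the density of \<open>M1\<close> with respect to the factor measure \<open>M\<close>. Both measures are
  invariant, hence so is \<open>f\<close>, and therefore the measure on the profinite integers with density
  \<open>f \<circ> \<phi>\<close> is invariant under the odometer. Unique ergodicity makes it Haar measure, and the images
  \<open>M1\<close> and \<open>M\<close> of the two agree.\<close>

lemma odometer_factor_rigid:
  assumes X: "subshift X" and H: "haar H" and phi: "\<phi> \<in> measurable H (restrict_space borel X)"
    and equiv: "AE h in H. \<phi> (odometer h) = shift 1 (\<phi> h)"
    and M: "M = distr H (restrict_space borel X) \<phi>"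
    and M1: "M1 \<in> invariant_measures X" and ac: "absolutely_continuous M M1"
  shows "M1 = M"
proof -
  let ?R = "restrict_space borel X"
  have Minv: "M \<in> invariant_measures X" unfolding M by (rule odometer_factor_invariant[OF X H phi equiv])
  interpret M: prob_space M by (rule invariant_measuresD[OF Minv])
  note sM = invariant_measuresD(1)[OF Minv] and sM1 = invariant_measuresD(1)[OF M1]
  have eqs: "sets M1 = sets M" using sM sM1 by simp
  note S = measurable_shift_subshift[OF X]
  have odo: "odometer \<in> measurable H residue_space"
    using measurable_odometer measurable_cong_sets[OF haarD(1)[OF H] refl] by blast
  have S': "shift 1 \<in> measurable M M" "shift (- 1) \<in> measurable M M"
    using S measurable_cong_sets[OF sM sM] by auto
  define f where "f = RN_deriv M M1"
  have f: "f \<in> borel_measurable M" by (simp add: f_def)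
  have dens: "density M f = M1" unfolding f_def by (rule M.density_RN_deriv[OF ac eqs])
  have d1: "distr M1 M (shift 1) = M1"
  proof -
    have "distr M1 M (shift 1) = distr M1 M1 (shift 1)" by (rule distr_cong) (use eqs in auto)
    then show ?thesis using invariant_measuresD(3)[OF M1] by simp
  qed
  have "AE x in M. RN_deriv (distr M M (shift 1)) (distr M1 M (shift 1)) (shift 1 x) = RN_deriv M M1 x"
    by (rule M.RN_deriv_distr[OF S'])
      (use ac eqs in \<open>auto simp: d1 invariant_measuresD(3)[OF Minv] shift_def\<close>)
  then have finv: "AE x in M. f (shift 1 x) = f x"
    by (simp add: f_def d1 invariant_measuresD(3)[OF Minv])
  have fR: "f \<in> borel_measurable ?R" using f measurable_cong_sets[OF sM refl] by blast
  have fphi: "(\<lambda>h. f (\<phi> h)) \<in> borel_measurable H" by (rule measurable_compose[OF phi fR])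
  have fphi': "(\<lambda>h. f (\<phi> h)) \<in> borel_measurable residue_space"
    using fphi measurable_cong_sets[OF haarD(1)[OF H] refl] by blast
  define H1 where "H1 = density H (\<lambda>h. f (\<phi> h))"
  have M1eq: "distr H1 ?R \<phi> = M1"
    unfolding H1_def density_distr[OF fR phi, symmetric] M[symmetric] by (rule dens)
  have phi1: "\<phi> \<in> measurable H1 ?R" using phi by (simp add: H1_def)
  have "haar H1"
  proof (rule haar_of_invariant)
    show "sets H1 = sets residue_space" using haarD(1)[OF H] by (simp add: H1_def)
    show "prob_space H1"
      by (rule prob_space_distrD[OF phi1]) (simp add: M1eq invariant_measuresD(2)[OF M1])
    show "AE h in H1. coherent h"
      unfolding H1_def AE_density[OF fphi] using haarD(3)[OF H] by eventually_elim simp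
    have "AE h in H. f (shift 1 (\<phi> h)) = f (\<phi> h)"
      using finv unfolding M by (rule AE_distrD[OF phi])
    with equiv have "AE h in H. f (\<phi> (odometer h)) = f (\<phi> h)" by eventually_elim simp
    then have "density H (\<lambda>h. f (\<phi> (odometer h))) = H1"
      unfolding H1_def
      by (intro density_cong fphi measurable_compose[OF odo fphi']) auto
    then have "distr H1 residue_space odometer = density (distr H residue_space odometer) (\<lambda>h. f (\<phi> h))"
      using density_distr[OF fphi' odo] by simp
    then show "distr H1 residue_space odometer = H1"
      by (simp add: haar_invariant[OF H] H1_def)
  qed
  then have "H1 = H" by (rule haar_unique[OF _ H])
  then show ?thesis using M1eq M by simp
qed

text \<open>Both parts of a proper convex combination are absolutely continuous with respect to it.\<close>

lemma odometer_factor_extreme: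
  assumes X: "subshift X" and H: "haar H" and phi: "\<phi> \<in> measurable H (restrict_space borel X)"
    and equiv: "AE h in H. \<phi> (odometer h) = shift 1 (\<phi> h)"
  shows "distr H (restrict_space borel X) \<phi> \<in> extreme_measures (invariant_measures X)"
proof -
  define M where "M = distr H (restrict_space borel X) \<phi>"
  have Minv: "M \<in> invariant_measures X"
    unfolding M_def by (rule odometer_factor_invariant[OF X H phi equiv])
  interpret M: prob_space M by (rule invariant_measuresD[OF Minv])
  have part: "M1 = M" if M1: "M1 \<in> invariant_measures X" and t: "t > 0"
    and le: "\<And>A. A \<in> sets M \<Longrightarrow> t * measure M1 A \<le> measure M A" for M1 and t :: real
  proof (rule odometer_factor_rigid[OF X H phi equiv M_def M1])
    interpret M1: prob_space M1 by (rule invariant_measuresD[OF M1])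
    show "absolutely_continuous M M1"
      unfolding absolutely_continuous_def
    proof
      fix A assume A: "A \<in> null_sets M"
      then have "t * measure M1 A \<le> 0" using le[of A] by (simp add: null_setsD2 measure_eq_0_null_sets)
      then have "measure M1 A = 0" using t by (simp add: mult_le_0_iff measure_le_0_iff)
      moreover have "A \<in> sets M1"
        using A invariant_measuresD(1)[OF Minv] invariant_measuresD(1)[OF M1] by auto
      ultimately show "A \<in> null_sets M1" by (auto simp: M1.emeasure_eq_measure null_sets_def)
    qed
  qed
  have "M1 = M \<and> M2 = M"
    if "M1 \<in> invariant_measures X" "M2 \<in> invariant_measures X" and t: "0 < t" "t < 1"
      and eq: "\<forall>A\<in>sets M. measure M A = t * measure M1 A + (1 - t) * measure M2 A"
    for M1 M2 and t :: real
  proof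
    show "M1 = M"
    proof (rule part[OF that(1) t(1)])
      fix A assume "A \<in> sets M"
      then have "measure M A = t * measure M1 A + (1 - t) * measure M2 A" using eq by blast
      then show "t * measure M1 A \<le> measure M A" using t by simp
    qed
    show "M2 = M"
    proof (rule part[OF that(2)])
      fix A assume "A \<in> sets M"
      then have "measure M A = t * measure M1 A + (1 - t) * measure M2 A" using eq by blast
      then show "(1 - t) * measure M2 A \<le> measure M A" using t by simp
    qed (use t in simp)
  qed
  then show ?thesis using Minv unfolding extreme_measures_def M_def[symmetric] by blast
qed

section \<open>Sieve measures\<close>

lemma sieve_event [measurable]: "Measurable.pred residue_space (\<lambda>h. sieve_map B w N h i)"
  unfolding sieve_map_def by measurable

lemma haar_event:
  assumes "haar H" "Measurable.pred residue_space P"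
  shows "{h. P h} \<in> sets H"
  using assms(2) haarD(1)[OF assms(1)] by (simp add: pred_def space_PiM)

lemma haar_sieve_window_error:
  assumes H: "haar H" and "0 \<notin> B" "\<And>m. w m \<Longrightarrow> eta {b\<in>B. b < K} m" "K \<le> N"
    and "upper_density (tail B K) \<le> ereal e" "e \<ge> 0" and W: "finite W"
  shows "measure H {h. \<exists>i\<in>W. sieve_map B w N h i \<noteq> w (int (h N) + i)} \<le> real (card W) * e"
proof -
  interpret prob_space H by (rule haarD[OF H])
  have eq: "{h. \<exists>i\<in>W. sieve_map B w N h i \<noteq> w (int (h N) + i)} = (\<Union>i\<in>W. {h. sieve_map B w N h i \<noteq> w (int (h N) + i)})"
    by auto
  have "{h. sieve_map B w N h i \<noteq> w (int (h N) + i)} \<in> events" for i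
    by (rule haar_event[OF H]) measurable
  then have "prob (\<Union>i\<in>W. {h. sieve_map B w N h i \<noteq> w (int (h N) + i)}) \<le> (\<Sum>i\<in>W. prob {h. sieve_map B w N h i \<noteq> w (int (h N) + i)})"
    by (intro finite_measure_subadditive_finite W) auto
  also have "\<dots> \<le> (\<Sum>i\<in>W. e)" by (intro sum_mono haar_sieve_error[OF assms(1-6)])
  finally show ?thesis unfolding eq by simp
qed

text \<open>Divisors below \<open>K\<close> may be moved from the sieve into the mask, at the price of the longer period
  \<open>fact K\<close>.\<close>

lemma sieve_map_refine:
  assumes "coherent h" "0 \<notin> B" "periodic (fact N) {m. w m}" "N \<le> K"
  shows "sieve_map B w N h = sieve_map B (\<lambda>m. w m \<and> eta {b\<in>B. b < K} m) K h"
proof (rule ext)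
  fix i
  have "h N = h K mod fact N" using assms unfolding coherent_def by blast
  then have "[int (h N) = int (h K)] (mod int (fact N))" by (simp add: cong_def zmod_int del: of_nat_fact)
  then have "[int (h N) + i = int (h K) + i] (mod int (fact N))" by (rule cong_add) simp
  then have w: "w (int (h N) + i) = w (int (h K) + i)" using periodic_cong[OF assms(3)] by simp
  have "int b dvd int (h b) + i \<longleftrightarrow> int b dvd int (h K) + i" if "b \<in> B" "b < K" for b
    using coherent_dvd_iff[OF assms(1), of b K] that assms(2) by (cases "b = 0") auto
  then show "sieve_map B w N h i = sieve_map B (\<lambda>m. w m \<and> eta {b\<in>B. b < K} m) K h i"
    unfolding sieve_map_def w eta_iff by blast
qed

text \<open>For integers \<open>m\<close> the coded configuration lies below a translate of \<open>\<eta>\<close>, so heredity puts it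
  into the orbit closure. For profinite \<open>h\<close> it agrees on a given window, up to an event of small
  probability, with the periodic pattern \<open>w'\<close> at the residue of \<open>h\<close>, and \<open>w'\<close> in turn differs from
  the pattern at integers only on a set of small density. As the error is arbitrarily small, almost
  every window is a word of \<open>\<eta>\<close>.\<close>

lemma AE_sieve_map_in_orbit_closure:
  assumes H: "haar H" and B0: "0 \<notin> B" and light: "(\<lambda>K. upper_density (tail B K)) \<longlonglongrightarrow> 0"
    and her: "hereditary (orbit_closure (eta B))" and w: "periodic (fact N) {m. w m}"
  shows "AE h in H. sieve_map B w N h \<in> orbit_closure (eta B)"
proof -
  interpret prob_space H by (rule haarD[OF H])
  have "AE h in H. \<exists>k. \<forall>i\<in>{-n..n}. sieve_map B w N h i = eta B (i + k)" for n
  proof -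
    let ?W = "{-n..n}"
    define bad where "bad x \<longleftrightarrow> \<not> (\<exists>k. \<forall>i\<in>?W. x i = eta B (i + k))" for x
    have bad_sets: "{h. bad (sieve_map B w N h)} \<in> events"
      unfolding bad_def by (rule haar_event[OF H]) measurable
    have "prob {h. bad (sieve_map B w N h)} \<le> d" if d: "d > 0" for d
    proof -
      define e where "e = d / (2 * (real (card ?W) + 1))"
      have e: "e > 0" "2 * (real (card ?W) * e) \<le> d" using d by (auto simp: e_def field_simps)
      have "\<forall>\<^sub>F K in sequentially. upper_density (tail B K) \<le> ereal e \<and> N \<le> K"
        using light_tails_eventually[OF light e(1)] eventually_ge_at_top[of N] by eventually_elim simp
      then obtain K where K: "upper_density (tail B K) \<le> ereal e" "N \<le> K"
        unfolding eventually_sequentially by blast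
      define w' where "w' m \<longleftrightarrow> w m \<and> eta {b\<in>B. b < K} m" for m
      have "fact N dvd (fact K :: nat)" using K(2) by (rule fact_dvd)
      then have "periodic (fact K) ({m. w m} \<inter> {m. eta {b\<in>B. b < K} m})"
        by (intro periodic_Int eta_periodic B0 periodic_dvd[OF w]) auto
      then have per: "periodic (fact K) {m. w' m}" by (simp add: w'_def Int_def)
      define G where "G = {m. bad (\<lambda>i. w' (m + i))}"
      have perG: "periodic (fact K) G" unfolding G_def by (rule periodic_window[OF per])
      have "G \<subseteq> (\<Union>i\<in>?W. {m. m + i \<in> tail B K})"
      proof (rule subsetI, rule ccontr)
        fix m assume m: "m \<in> G" "m \<notin> (\<Union>i\<in>?W. {m. m + i \<in> tail B K})"
        define x where "x = (\<lambda>i. w (m + i) \<and> eta B (i + m))"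
        have "shift m (eta B) \<in> orbit_closure (eta B)"
          by (rule shift_in_orbit_closure) (auto simp: orbit_closure_iff intro: exI[of _ 0])
        moreover have "x \<le> shift m (eta B)" by (auto simp: x_def shift_def le_fun_def)
        ultimately have "x \<in> orbit_closure (eta B)" using her unfolding hereditary_def by blast
        then have "\<not> bad x" unfolding orbit_closure_iff bad_def by blast
        moreover have "x i = w' (m + i)" if "i \<in> ?W" for i
        proof -
          have "m + i \<notin> tail B K" using that m(2) by blast
          then have "eta B (m + i) \<longleftrightarrow> eta {b\<in>B. b < K} (m + i)"
            unfolding mem_tail eta_iff by (metis (mono_tags, lifting) mem_Collect_eq not_le)
          then show ?thesis unfolding x_def w'_def by (simp add: add.commute)
        qed
        ultimately have "\<not> bad (\<lambda>i. w' (m + i))" unfolding bad_def by simp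
        then show False using m(1) by (simp add: G_def)
      qed
      then have "upper_density G \<le> upper_density (\<Union>i\<in>?W. {m. m + i \<in> tail B K})"
        by (rule upper_density_mono)
      also have "\<dots> \<le> ereal (\<Sum>i\<in>?W. e)"
        by (rule upper_density_UN_le) (use upper_density_translate[OF K(1)] e in auto)
      finally have G: "freq (fact K) G \<le> real (card ?W) * e"
        by (simp add: upper_density_periodic[OF perG])
      let ?E = "{h. \<exists>i\<in>?W. sieve_map B w' K h i \<noteq> w' (int (h K) + i)}"
      have E: "prob ?E \<le> real (card ?W) * e"
        by (rule haar_sieve_window_error[OF H B0 _ order_refl K(1)]) (use e in \<open>auto simp: w'_def\<close>)
      have Es: "?E \<in> events" by (rule haar_event[OF H]) measurable
      have Gs: "{h. int (h K) \<in> G} \<in> events"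
        unfolding haarD(1)[OF H] by (rule residue_event_sets)
      have "prob {h. bad (sieve_map B w N h)} \<le> prob (?E \<union> {h. int (h K) \<in> G})"
      proof (rule finite_measure_mono_AE)
        show "AE h in H. h \<in> {h. bad (sieve_map B w N h)} \<longrightarrow> h \<in> ?E \<union> {h. int (h K) \<in> G}"
          using haarD(3)[OF H]
        proof (eventually_elim, intro impI)
          fix h assume h0: "coherent h" "h \<in> {h. bad (sieve_map B w N h)}"
          show "h \<in> ?E \<union> {h. int (h K) \<in> G}"
          proof (rule ccontr)
            assume "h \<notin> ?E \<union> {h. int (h K) \<in> G}"
            note h = h0 this
            have "sieve_map B w N h = sieve_map B w' K h"
              unfolding w'_def by (rule sieve_map_refine[OF h(1) B0 w K(2)])
            then have "bad (\<lambda>i. w' (int (h K) + i))" using h(2,3) by (simp add: bad_def)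
            then show False using h(3) by (simp add: G_def)
          qed
        qed
      qed (use Es Gs in auto)
      also have "\<dots> \<le> prob ?E + prob {h. int (h K) \<in> G}"
        by (rule measure_Un_le[OF Es Gs])
      also have "\<dots> \<le> d" using E G e(2) haar_freq[OF H, of K G] by linarith
      finally show ?thesis .
    qed
    then have "prob {h. bad (sieve_map B w N h)} = 0"
      by (metis dense_ge measure_nonneg order_antisym)
    then have "AE h in H. h \<notin> {h. bad (sieve_map B w N h)}"
      using bad_sets by (subst (asm) prob_eq_0) auto
    then show ?thesis by eventually_elim (simp add: bad_def)
  qed
  then show ?thesis unfolding orbit_closure_iff by (subst AE_all_countable) blast
qed

text \<open>The extreme measures used for the approximation: laws of \<open>sieve_map B w N\<close>, whose window statistics
  are those of the periodic mask \<open>w\<close> up to the density of a tail times the length of the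
  window.\<close>

lemma sieve_measure_exists:
  assumes B0: "0 \<notin> B" and light: "(\<lambda>K. upper_density (tail B K)) \<longlonglongrightarrow> 0"
    and her: "hereditary (orbit_closure (eta B))" and w: "periodic (fact N) {m. w m}"
    and le: "\<And>m. w m \<Longrightarrow> eta {b\<in>B. b < K} m" and "K \<le> N"
    and e: "upper_density (tail B K) \<le> ereal e" "e \<ge> 0"
  shows "\<exists>\<nu>\<in>extreme_measures (invariant_measures (orbit_closure (eta B))). \<forall>n u.
    \<bar>measure \<nu> (orbit_closure (eta B) \<inter> cylinder n u) - freq (fact N) {m. shift m w \<in> cylinder n u}\<bar>
      \<le> real (card {-n..n}) * e"
proof -
  obtain H where H: "haar H" using haar_exists by blast
  interpret prob_space H by (rule haarD[OF H])
  define X where "X = orbit_closure (eta B)"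
  have X: "subshift X" unfolding X_def by (rule subshift_orbit_closure)
  have Xb: "X \<in> sets borel" using X by (simp add: subshift_def borel_closed)
  have inX: "AE h in H. sieve_map B w N h \<in> X"
    unfolding X_def by (rule AE_sieve_map_in_orbit_closure[OF H B0 light her w])
  have "eta B \<in> X" unfolding X_def orbit_closure_iff by (auto intro: exI[of _ 0])
  \<comment> \<open>The value \<open>eta B\<close> on the exceptional null set makes all values lie in \<open>X\<close>.\<close>
  define \<phi> where "\<phi> h = (if sieve_map B w N h \<in> X then sieve_map B w N h else eta B)" for h
  have sm: "sieve_map B w N \<in> measurable H borel"
    using measurable_sieve_map measurable_cong_sets[OF haarD(1)[OF H] refl] by blast
  have phi: "\<phi> \<in> measurable H (restrict_space borel X)"
  proof (rule measurable_restrict_space2)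
    show "\<phi> \<in> space H \<rightarrow> X" using \<open>eta B \<in> X\<close> by (auto simp: \<phi>_def)
    show "\<phi> \<in> measurable H borel"
      unfolding \<phi>_def using sm Xb by measurable
  qed
  have phi_eq: "AE h in H. \<phi> h = sieve_map B w N h" using inX by eventually_elim (simp add: \<phi>_def)
  have odo: "odometer \<in> measurable H residue_space"
    using measurable_odometer measurable_cong_sets[OF haarD(1)[OF H] refl] by blast
  have "AE h in distr H residue_space odometer. \<phi> h = sieve_map B w N h"
    unfolding haar_invariant[OF H] by (rule phi_eq)
  then have "AE h in H. \<phi> (odometer h) = sieve_map B w N (odometer h)" by (rule AE_distrD[OF odo])
  with phi_eq have equiv: "AE h in H. \<phi> (odometer h) = shift 1 (\<phi> h)"
    by eventually_elim (simp add: sieve_map_odometer[OF w B0])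
  define \<nu> where "\<nu> = distr H (restrict_space borel X) \<phi>"
  have "\<bar>measure \<nu> (X \<inter> cylinder n u) - freq (fact N) {m. shift m w \<in> cylinder n u}\<bar>
      \<le> real (card {-n..n}) * e" for n u
  proof -
    let ?A = "{h. sieve_map B w N h \<in> cylinder n u}"
    let ?F = "{h. int (h N) \<in> {m. shift m w \<in> cylinder n u}}"
    let ?E = "{h. \<exists>i\<in>{-n..n}. sieve_map B w N h i \<noteq> w (int (h N) + i)}"
    have Es: "?E \<in> events" by (rule haar_event[OF H]) measurable
    have Fs: "?F \<in> events" unfolding haarD(1)[OF H] by (rule residue_event_sets)
    have As: "?A \<in> events" unfolding cylinder_def mem_Collect_eq by (rule haar_event[OF H]) measurable
    have E: "prob ?E \<le> real (card {-n..n}) * e"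
      by (rule haar_sieve_window_error[OF H B0 le \<open>K \<le> N\<close> e]) auto
    have cyl: "X \<inter> cylinder n u \<in> sets (restrict_space borel X)"
      using cylinder_sets[of n u] Xb by (subst sets_restrict_space_iff) auto
    have "measure \<nu> (X \<inter> cylinder n u) = prob (\<phi> -` (X \<inter> cylinder n u) \<inter> space H)"
      unfolding \<nu>_def by (rule measure_distr[OF phi cyl])
    also have "\<dots> = prob ?A"
    proof (rule finite_measure_eq_AE)
      show "AE h in H. h \<in> \<phi> -` (X \<inter> cylinder n u) \<inter> space H \<longleftrightarrow> h \<in> ?A"
        using inX by eventually_elim (simp add: \<phi>_def haarD(4)[OF H])
    qed (rule measurable_sets[OF phi cyl] As)+
    finally have nu: "measure \<nu> (X \<inter> cylinder n u) = prob ?A" .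
    have "?A \<subseteq> ?F \<union> ?E" "?F \<subseteq> ?A \<union> ?E"
      by (auto simp: cylinder_def shift_def add.commute)
    then have "prob ?A \<le> prob ?F + prob ?E" "prob ?F \<le> prob ?A + prob ?E"
      using As Fs Es by (meson finite_measure_mono measure_Un_le order_trans sets.Un)+
    then show ?thesis using E haar_freq[OF H, of N "{m. shift m w \<in> cylinder n u}"] nu by linarith
  qed
  moreover have "\<nu> \<in> extreme_measures (invariant_measures X)"
    unfolding \<nu>_def by (rule odometer_factor_extreme[OF X H phi equiv])
  ultimately show ?thesis unfolding X_def by blast
qed

section \<open>Periodic models of an invariant measure\<close>

text \<open>The points of \<open>M\<close> fall into finitely many cells according to the sets \<open>E u\<close> containing them. Taking
  one representative of each cell, repeated in proportion to the mass of the cell, imitates \<open>M\<close> on all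
  \<open>E u\<close> at once; rounding the multiplicities to integers costs at most one point per cell.\<close>

lemma empirical_points:
  fixes E :: "'u \<Rightarrow> 'a set"
  assumes "prob_space M" and U: "finite U" and E: "\<And>u. u \<in> U \<Longrightarrow> E u \<in> sets M" and \<epsilon>: "\<epsilon> > 0"
  obtains D :: nat and x :: "nat \<Rightarrow> 'a" where "D > 0" "\<And>j. j < D \<Longrightarrow> x j \<in> space M"
    "\<And>u. u \<in> U \<Longrightarrow> \<bar>real (card {j. j < D \<and> x j \<in> E u}) - real D * measure M (E u)\<bar> \<le> \<epsilon> * real D"
proof -
  interpret prob_space M by fact
  define pat where "pat x = {u \<in> U. x \<in> E u}" for x
  define cell where "cell A = {x \<in> space M. pat x = A}" for A
  define At where "At = {A. A \<subseteq> U \<and> cell A \<noteq> {}}"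
  have fin: "finite At" using U by (auto simp: At_def)
  have cell_sets: "cell A \<in> events" if "A \<subseteq> U" for A
  proof -
    have "cell A = {x \<in> space M. \<forall>u\<in>U. x \<in> E u \<longleftrightarrow> u \<in> A}"
      using that by (auto simp: cell_def pat_def)
    also have "\<dots> \<in> events"
    proof (rule sets.sets_Collect_finite_All[OF _ U])
      fix u assume "u \<in> U"
      then have "{x \<in> space M. x \<in> E u} \<in> events" using E[of u] by (simp add: sets.sets_into_space Int_absorb2 Collect_conj_eq Int_def[symmetric])
      then show "{x \<in> space M. (x \<in> E u) = (u \<in> A)} \<in> events" by (cases "u \<in> A") (auto simp: sets.sets_Collect_neg)
    qed
    finally show ?thesis .
  qed
  define rep where "rep A = (SOME x. x \<in> cell A)" for A
  have rep: "rep A \<in> cell A" if "A \<in> At" for A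
    using that some_in_eq[of "cell A"] by (auto simp: At_def rep_def)
  define p where "p A = prob (cell A)" for A
  have p0: "p A \<ge> 0" for A by (simp add: p_def)
  have disj: "disjoint_family_on cell S" for S by (auto simp: disjoint_family_on_def cell_def)
  have sum_p: "prob (\<Union>A\<in>S. cell A) = (\<Sum>A\<in>S. p A)" if "S \<subseteq> At" for S
    unfolding p_def using that fin cell_sets
    by (intro finite_measure_finite_Union disj) (auto simp: At_def intro: finite_subset)
  have "(\<Union>A\<in>At. cell A) = space M" by (auto simp: At_def cell_def pat_def)
  with sum_p[of At] have p1: "(\<Sum>A\<in>At. p A) = 1" by (simp add: prob_space)
  then have At: "card At > 0" using fin by (auto simp: card_gt_0_iff)
  have pE: "prob (E u) = (\<Sum>A\<in>{A\<in>At. u \<in> A}. p A)" if "u \<in> U" for u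
  proof -
    have "(\<Union>A\<in>{A\<in>At. u \<in> A}. cell A) = E u"
    proof (intro set_eqI iffI)
      fix x assume x: "x \<in> E u"
      then have "x \<in> cell (pat x)" using sets.sets_into_space[OF E[OF that]] by (auto simp: cell_def)
      then show "x \<in> (\<Union>A\<in>{A\<in>At. u \<in> A}. cell A)"
        using x that by (intro UN_I[of "pat x"]) (auto simp: At_def pat_def)
    qed (auto simp: cell_def pat_def)
    with sum_p[of "{A\<in>At. u \<in> A}"] show ?thesis by auto
  qed
  \<comment> \<open>\<open>R\<close> is the intended number of points; rounding adds at most \<open>card At\<close>, a fraction \<open>\<epsilon>\<close>.\<close>
  define R where "R = real (card At) / \<epsilon>"
  have R: "R > 0" using At \<epsilon> by (simp add: R_def)
  define m where "m A = nat \<lceil>R * p A\<rceil>" for A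
  define \<delta> where "\<delta> A = real (m A) - R * p A" for A
  have \<delta>: "0 \<le> \<delta> A" "\<delta> A \<le> 1" for A
  proof -
    have "0 \<le> R * p A" using R p0 by simp
    then show "0 \<le> \<delta> A" "\<delta> A \<le> 1" unfolding \<delta>_def m_def by linarith+
  qed
  have sum_m: "real (\<Sum>A\<in>S. m A) = R * (\<Sum>A\<in>S. p A) + (\<Sum>A\<in>S. \<delta> A)" for S
    by (simp add: \<delta>_def sum_subtractf sum_distrib_left)
  define J where "J = (SIGMA A:At. {..<m A})"
  have finJ: "finite J" using fin by (simp add: J_def)
  define D where "D = card J"
  have "D = (\<Sum>A\<in>At. m A)" unfolding D_def J_def using fin by (simp add: card_SigmaI)
  then have D: "real D = R + (\<Sum>A\<in>At. \<delta> A)" using sum_m[of At] p1 by simp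
  define \<Delta> where "\<Delta> = (\<Sum>A\<in>At. \<delta> A)"
  have \<Delta>: "0 \<le> \<Delta>" "\<Delta> \<le> real (card At)"
    using \<delta> sum_bounded_above[of At \<delta> 1] by (auto simp: \<Delta>_def intro: sum_nonneg)
  obtain f where f: "bij_betw f {..<D} J"
    using ex_bij_betw_nat_finite[OF finJ] unfolding D_def atLeast0LessThan by blast
  define x where "x j = rep (fst (f j))" for j
  have fJ: "fst (f j) \<in> At" if "j < D" for j
  proof -
    have "f j \<in> J" using bij_betwE[OF f] that by simp
    then show ?thesis by (cases "f j") (simp add: J_def)
  qed
  show ?thesis
  proof
    show "D > 0" using D \<Delta> R by (simp add: \<Delta>_def[symmetric] flip: of_nat_0_less_iff)
    show "x j \<in> space M" if "j < D" for j
      using rep[OF fJ[OF that]] by (simp add: x_def cell_def)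
    fix u assume u: "u \<in> U"
    let ?S = "{A\<in>At. u \<in> A}"
    have mem: "x j \<in> E u \<longleftrightarrow> u \<in> fst (f j)" if "j < D" for j
    proof -
      have "pat (x j) = fst (f j)" using rep[OF fJ[OF that]] by (simp add: x_def cell_def)
      then show ?thesis using u unfolding pat_def by blast
    qed
    have "bij_betw f {j. j < D \<and> x j \<in> E u} (SIGMA A:?S. {..<m A})"
    proof (rule bij_betw_subset[OF f])
      show "f ` {j. j < D \<and> x j \<in> E u} = (SIGMA A:?S. {..<m A})"
      proof (intro set_eqI iffI)
        fix z assume "z \<in> f ` {j. j < D \<and> x j \<in> E u}"
        then obtain j where j: "j < D" "x j \<in> E u" "z = f j" by blast
        then have "z \<in> J" "u \<in> fst z" using mem bij_betwE[OF f] by auto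
        then show "z \<in> (SIGMA A:?S. {..<m A})" by (auto simp: J_def)
      next
        fix z assume z: "z \<in> (SIGMA A:?S. {..<m A})"
        then have "z \<in> J" "u \<in> fst z" by (auto simp: J_def)
        then obtain j where "j < D" "z = f j" using f unfolding bij_betw_def by blast
        then show "z \<in> f ` {j. j < D \<and> x j \<in> E u}" using mem \<open>u \<in> fst z\<close> by auto
      qed
    qed auto
    then have "card {j. j < D \<and> x j \<in> E u} = card (SIGMA A:?S. {..<m A})" by (rule bij_betw_same_card)
    also have "\<dots> = (\<Sum>A\<in>?S. m A)" using fin by (simp add: card_SigmaI)
    finally have c: "real (card {j. j < D \<and> x j \<in> E u}) = R * prob (E u) + (\<Sum>A\<in>?S. \<delta> A)"
      using sum_m[of ?S] pE[OF u] by simp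
    have "(\<Sum>A\<in>?S. \<delta> A) \<le> \<Delta>" "0 \<le> (\<Sum>A\<in>?S. \<delta> A)"
      unfolding \<Delta>_def using \<delta> fin by (auto intro!: sum_mono2 sum_nonneg)
    moreover have "0 \<le> \<Delta> * prob (E u)" "\<Delta> * prob (E u) \<le> \<Delta>"
      using \<Delta> by (auto intro: mult_left_le)
    moreover have "real D * prob (E u) = R * prob (E u) + \<Delta> * prob (E u)"
      using D by (simp add: \<Delta>_def algebra_simps)
    ultimately have "\<bar>real (card {j. j < D \<and> x j \<in> E u}) - real D * prob (E u)\<bar> \<le> \<Delta>"
      using c by linarith
    also have "\<Delta> \<le> \<epsilon> * R" using \<Delta> \<epsilon> by (simp add: R_def)
    also have "\<dots> \<le> \<epsilon> * real D" using D \<Delta> \<epsilon> by (simp add: \<Delta>_def[symmetric])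
    finally show "\<bar>real (card {j. j < D \<and> x j \<in> E u}) - real D * prob (E u)\<bar> \<le> \<epsilon> * real D" .
  qed
qed

lemma shifted_event_sets:
  assumes M: "M \<in> invariant_measures X" and X: "subshift X" and A: "A \<in> sets borel"
  shows "{x\<in>X. shift k x \<in> A} \<in> sets M"
proof -
  have Xb: "X \<in> sets borel" using X by (simp add: subshift_def borel_closed)
  have "shift k -` A \<inter> space borel \<in> sets borel" by (rule measurable_sets[OF measurable_shift A])
  then have "X \<inter> (shift k -` A) \<in> sets borel" using Xb by auto
  moreover have "{x\<in>X. shift k x \<in> A} = X \<inter> (shift k -` A)" by auto
  ultimately show ?thesis
    unfolding invariant_measuresD(1)[OF M] using Xb by (subst sets_restrict_space_iff) auto
qed

lemma invariant_measure_shift: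
  assumes M: "M \<in> invariant_measures X" and X: "subshift X" and A: "A \<in> sets borel"
  shows "measure M {x\<in>X. shift (int k) x \<in> A} = measure M (X \<inter> A)"
proof -
  have sM: "sets M = sets (restrict_space borel X)" by (rule invariant_measuresD[OF M])
  have S: "shift 1 \<in> measurable M M"
    using measurable_shift_subshift(1)[OF X] measurable_cong_sets[OF sM sM] by blast
  show ?thesis
  proof (induction k)
    case 0
    have "{x\<in>X. shift (int 0) x \<in> A} = X \<inter> A" by (auto simp: shift_0)
    then show ?case by simp
  next
    case (Suc k)
    have "{x\<in>X. shift (int (Suc k)) x \<in> A} = shift 1 -` {x\<in>X. shift (int k) x \<in> A} \<inter> space M"
      using subshift_shift(1)[OF X] by (auto simp: invariant_measuresD(4)[OF M] shift_def algebra_simps)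
    then have "measure M {x\<in>X. shift (int (Suc k)) x \<in> A} = measure (distr M M (shift 1)) {x\<in>X. shift (int k) x \<in> A}"
      by (simp add: measure_distr[OF S shifted_event_sets[OF M X A]])
    then show ?case using Suc invariant_measuresD(3)[OF M] by simp
  qed
qed

text \<open>Cut words of length \<open>L\<close> from finitely many points that imitate \<open>M\<close> on all windows inside
  \<open>{0..<L}\<close>, and repeat their concatenation periodically. By invariance each offset inside the words
  sees the window statistics of \<open>M\<close>, so the concatenation has them too, up to the windows that meet
  the ends of the words. To stay below \<open>g\<close>, the \<open>j\<close>-th word is delayed by the phase \<open>\<kappa> j < P\<close> at which
  it lies below \<open>g\<close>, inside a block of length \<open>L + P\<close> that is a multiple of the period \<open>P\<close>; the
  padding is negligible when \<open>L\<close> is large.\<close>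

lemma periodic_model:
  fixes n P :: nat
  assumes M: "M \<in> invariant_measures X" and X: "subshift X" and g: "periodic P {m. g m}"
    and below: "\<And>x L. x \<in> X \<Longrightarrow> \<exists>k. \<forall>i\<in>{0..<int L}. x i \<longrightarrow> g (i + k)"
    and U: "finite U" and \<epsilon>: "\<epsilon> > 0"
  obtains \<Lambda> w where "periodic \<Lambda> {m. w m}" "\<And>m. w m \<Longrightarrow> g m"
    "\<And>u. u \<in> U \<Longrightarrow> \<bar>freq \<Lambda> {m. shift m w \<in> cylinder (int n) u} - measure M (X \<inter> cylinder (int n) u)\<bar> \<le> \<epsilon>"
proof -
  have P: "P > 0" using g by (simp add: periodic_def)
  interpret M: prob_space M by (rule invariant_measuresD[OF M])
  obtain q :: nat where q: "real q \<ge> 4 * real (P + 2 * n) / \<epsilon>" "q \<ge> 2 * n"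
  proof -
    obtain q0 :: nat where "real q0 \<ge> 4 * real (P + 2 * n) / \<epsilon>" using real_arch_simple by blast
    then show thesis by (intro that[of "q0 + 2 * n"]) auto
  qed
  define L where "L = P * q"
  define b where "b = L + P"
  have qL: "q \<le> L" using P by (simp add: L_def)
  have L: "2 * n \<le> L" using qL q(2) by linarith
  have b: "b > 0" "P dvd b" using P by (simp_all add: b_def L_def)
  have bq: "real q \<le> real b" using qL by (simp add: b_def)
  have b\<epsilon>: "2 * real (P + 2 * n) \<le> \<epsilon> / 2 * real b"
  proof -
    have "4 * real (P + 2 * n) / \<epsilon> \<le> real b" using q bq by linarith
    then show ?thesis using \<epsilon> by (simp add: field_simps)
  qed
  define I where "I = {n..<L - n}"
  have cI: "card I = L - 2 * n" "finite I" by (auto simp: I_def)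
  define E where "E = (\<lambda>(u, i). {x\<in>X. shift (int i) x \<in> cylinder (int n) u})"
  have Ev: "E z \<in> sets M" for z
    unfolding E_def by (cases z) (auto intro!: shifted_event_sets[OF M X] cylinder_sets)
  obtain D x where D: "D > 0" and xX: "\<And>j. j < D \<Longrightarrow> x j \<in> X"
    and x: "\<And>z. z \<in> U \<times> I \<Longrightarrow> \<bar>real (card {j. j < D \<and> x j \<in> E z}) - real D * measure M (E z)\<bar> \<le> \<epsilon> / 2 * real D"
    using empirical_points[OF M.prob_space_axioms, of "U \<times> I" E "\<epsilon> / 2"] U cI(2) Ev \<epsilon>
    unfolding invariant_measuresD(4)[OF M] by auto
  have "\<exists>k::nat. k < P \<and> (\<forall>i\<in>{0..<int L}. x j i \<longrightarrow> g (i + int k))" if j: "j < D" for j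
  proof -
    obtain k where k: "\<forall>i\<in>{0..<int L}. x j i \<longrightarrow> g (i + k)" using below[OF xX[OF j]] by blast
    have "[i + k = i + int (nat (k mod int P))] (mod int P)" for i
      using P by (simp add: cong_def mod_simps)
    then have "g (i + k) = g (i + int (nat (k mod int P)))" for i using periodic_cong[OF g] by simp
    moreover have "nat (k mod int P) < P" using P by (simp add: nat_less_iff)
    ultimately show ?thesis using k by (intro exI[of _ "nat (k mod int P)"]) auto
  qed
  then obtain \<kappa> where \<kappa>: "\<And>j. j < D \<Longrightarrow> \<kappa> j < P"
    "\<And>j i. j < D \<Longrightarrow> i \<in> {0..<int L} \<Longrightarrow> x j i \<Longrightarrow> g (i + int (\<kappa> j))" by metis
  define \<Lambda> where "\<Lambda> = D * b"
  have \<Lambda>: "\<Lambda> > 0" using D b by (simp add: \<Lambda>_def)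
  \<comment> \<open>Modulo \<open>\<Lambda>\<close>, \<open>m\<close> lies in block \<open>blk m\<close>, at offset \<open>pos m\<close> from the start of the word in it; a negative offset or one
    beyond \<open>L\<close> is padding.\<close>
  define blk where "blk m = nat (m mod int \<Lambda> div int b)" for m
  define pos where "pos m = m mod int \<Lambda> mod int b - int (\<kappa> (blk m))" for m
  define w where "w m \<longleftrightarrow> 0 \<le> pos m \<and> pos m < int L \<and> x (blk m) (pos m)" for m
  have blk_less: "blk m < D" for m
  proof -
    have "m mod int \<Lambda> < int D * int b" using \<Lambda> by (simp add: \<Lambda>_def)
    moreover have "m mod int \<Lambda> div int b * int b \<le> m mod int \<Lambda>"
      using div_mult_mod_eq[of "m mod int \<Lambda>" "int b"] pos_mod_sign[of "int b" "m mod int \<Lambda>"] b by linarith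
    ultimately have "m mod int \<Lambda> div int b * int b < int D * int b" by (rule le_less_trans[rotated])
    then have "m mod int \<Lambda> div int b < int D" by (rule mult_right_less_imp_less) simp
    then show ?thesis unfolding blk_def using \<Lambda> D by (simp add: nat_less_iff pos_imp_zdiv_nonneg_iff b)
  qed
  have at: "blk (int (j * b + \<kappa> j) + s) = j" "pos (int (j * b + \<kappa> j) + s) = s"
    if j: "j < D" and s: "0 \<le> s" "s < int L" for j s
  proof -
    have r: "0 \<le> int (\<kappa> j) + s" "int (\<kappa> j) + s < int b" using s \<kappa>(1)[OF j] by (auto simp: b_def)
    have eq: "int (j * b + \<kappa> j) + s = int j * int b + (int (\<kappa> j) + s)" by simp
    have "int j * int b + (int (\<kappa> j) + s) < (int j + 1) * int b" using r by (simp add: algebra_simps)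
    also have "\<dots> \<le> int D * int b" using j by (intro mult_right_mono) auto
    finally have "(int (j * b + \<kappa> j) + s) mod int \<Lambda> = int j * int b + (int (\<kappa> j) + s)"
      unfolding eq using r by (intro mod_pos_pos_trivial) (auto simp: \<Lambda>_def)
    then show "blk (int (j * b + \<kappa> j) + s) = j" "pos (int (j * b + \<kappa> j) + s) = s"
      using r b by (simp_all add: blk_def pos_def)
  qed
  have w_at: "w (int (j * b + \<kappa> j) + s) = x j s" if "j < D" "0 \<le> s" "s < int L" for j s
    using at[OF that] that by (simp add: w_def)
  show ?thesis
  proof
    show "periodic \<Lambda> {m. w m}"
      using \<Lambda> by (simp add: periodic_def w_def blk_def pos_def)
    show "g m" if m: "w m" for m
    proof -
      have "g (pos m + int (\<kappa> (blk m)))" using m \<kappa>(2)[OF blk_less] by (simp add: w_def)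
      then have "g (m mod int \<Lambda> mod int b)" by (simp add: pos_def)
      moreover have "[m mod int \<Lambda> mod int b = m] (mod int P)"
      proof -
        have "int P dvd int b" "int b dvd int \<Lambda>" using b by (auto simp: \<Lambda>_def)
        then show ?thesis by (simp add: cong_def mod_mod_cancel dvd_trans)
      qed
      ultimately show ?thesis using periodic_cong[OF g] by simp
    qed
    fix u assume u: "u \<in> U"
    define p where "p = measure M (X \<inter> cylinder (int n) u)"
    have p: "0 \<le> p" "p \<le> 1" by (auto simp: p_def)
    define A where "A = {m. shift m w \<in> cylinder (int n) u}"
    define F where "F = (\<lambda>(i, j). int (j * b + \<kappa> j) + int i)"
    \<comment> \<open>\<open>F\<close> enumerates the places at which the whole window lies inside one word; \<open>out\<close> below counts the
      other occurrences, of which there are at most \<open>D * (P + 2 * n)\<close>.\<close>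
    define Good where "Good = (SIGMA i:I. {j. j < D \<and> x j \<in> E (u, i)})"
    have I: "0 \<le> int i + k" "int i + k < int L" if "i \<in> I" "k \<in> {- int n..int n}" for i k
      using that L by (auto simp: I_def)
    have F0: "blk (F (i, j)) = j" "pos (F (i, j)) = int i" if "i \<in> I" "j < D" for i j
      using at[OF that(2), of "int i"] I[OF that(1), of 0] by (simp_all add: F_def)
    have inj: "inj_on F (I \<times> {..<D})"
    proof (rule inj_onI)
      fix y z assume yz: "y \<in> I \<times> {..<D}" "z \<in> I \<times> {..<D}" "F y = F z"
      obtain i j k l where "y = (i, j)" "z = (k, l)" by fastforce
      then show "y = z" using yz F0[of i j] F0[of k l] by auto
    qed
    have FA: "F (i, j) \<in> A \<longleftrightarrow> (i, j) \<in> Good" if ij: "i \<in> I" "j < D" for i j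
    proof -
      have "w (k + F (i, j)) = x j (k + int i)" if k: "k \<in> {- int n..int n}" for k
        using w_at[OF ij(2) I[OF ij(1) k]] by (simp add: F_def algebra_simps)
      then have "F (i, j) \<in> A \<longleftrightarrow> shift (int i) (x j) \<in> cylinder (int n) u"
        unfolding A_def cylinder_def shift_def by auto
      then show ?thesis using ij xX by (auto simp: Good_def E_def)
    qed
    have Frange: "F ` (I \<times> {..<D}) \<subseteq> {0..<int \<Lambda>}"
    proof (rule subsetI)
      fix m assume "m \<in> F ` (I \<times> {..<D})"
      then obtain i j where ij: "i \<in> I" "j < D" "m = F (i, j)" by auto
      have "\<kappa> j + i < b" using \<kappa>(1)[OF ij(2)] I[OF ij(1), of 0] by (auto simp: b_def)
      then have "j * b + \<kappa> j + i < (j + 1) * b" by simp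
      also have "\<dots> \<le> D * b" using ij(2) by (intro mult_right_mono) auto
      finally show "m \<in> {0..<int \<Lambda>}" by (simp add: ij(3) F_def \<Lambda>_def flip: of_nat_add of_nat_mult)
    qed
    have Gsub: "Good \<subseteq> I \<times> {..<D}" by (auto simp: Good_def)
    have finG: "finite (I \<times> {..<D})" using cI by simp
    have cG: "card (I \<times> {..<D}) = D * (L - 2 * n)" using cI by (simp add: card_cartesian_product)
    have split: "A \<inter> {0..<int \<Lambda>} = F ` Good \<union> (A \<inter> ({0..<int \<Lambda>} - F ` (I \<times> {..<D})))"
    proof (intro set_eqI iffI)
      fix m assume m: "m \<in> A \<inter> {0..<int \<Lambda>}"
      show "m \<in> F ` Good \<union> (A \<inter> ({0..<int \<Lambda>} - F ` (I \<times> {..<D})))"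
      proof (cases "m \<in> F ` (I \<times> {..<D})")
        case True
        then obtain i j where ij: "i \<in> I" "j < D" "m = F (i, j)" by auto
        then have "(i, j) \<in> Good" using m FA by auto
        then show ?thesis using ij(3) by blast
      qed (use m in blast)
    next
      fix m assume "m \<in> F ` Good \<union> (A \<inter> ({0..<int \<Lambda>} - F ` (I \<times> {..<D})))"
      then show "m \<in> A \<inter> {0..<int \<Lambda>}"
      proof
        assume "m \<in> F ` Good"
        then obtain i j where ij: "(i, j) \<in> Good" "m = F (i, j)" by auto
        then have "i \<in> I" "j < D" using Gsub by auto
        then show ?thesis using ij FA Frange by auto
      qed blast
    qed
    define out where "out = card (A \<inter> ({0..<int \<Lambda>} - F ` (I \<times> {..<D})))"
    have "card (A \<inter> {0..<int \<Lambda>}) = card (F ` Good) + out"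
      unfolding out_def by (subst split, rule card_Un_disjoint) (use finG Gsub in \<open>auto intro: finite_subset\<close>)
    also have "card (F ` Good) = card Good" by (rule card_image[OF inj_on_subset[OF inj Gsub]])
    finally have cA: "card (A \<inter> {0..<int \<Lambda>}) = card Good + out" .
    have "out \<le> card ({0..<int \<Lambda>} - F ` (I \<times> {..<D}))"
      unfolding out_def by (rule card_mono) auto
    also have "\<dots> = \<Lambda> - D * (L - 2 * n)"
      using Frange finG by (subst card_Diff_subset) (auto simp: card_image[OF inj] cG)
    finally have "real out \<le> real (\<Lambda> - D * (L - 2 * n))" by (simp only: of_nat_le_iff)
    also have "\<dots> = real \<Lambda> - real D * (real L - 2 * real n)"
      using L by (subst of_nat_diff) (auto simp: \<Lambda>_def b_def of_nat_diff intro: mult_left_mono)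
    finally have out: "real out \<le> real D * real (P + 2 * n)"
      by (simp add: \<Lambda>_def b_def algebra_simps)
    have "real (card Good) = (\<Sum>i\<in>I. real (card {j. j < D \<and> x j \<in> E (u, i)}))"
      unfolding Good_def using cI by (subst card_SigmaI) auto
    moreover have "measure M (E (u, i)) = p" for i
      unfolding E_def p_def using invariant_measure_shift[OF M X cylinder_sets] by simp
    ultimately have "\<bar>real (card Good) - (\<Sum>i\<in>I. real D * p)\<bar> \<le> (\<Sum>i\<in>I. \<epsilon> / 2 * real D)"
      using x u by (simp only: sum_subtractf[symmetric]) (rule sum_abs[THEN order_trans], rule sum_mono, force)
    then have good: "\<bar>real (card Good) - (real L - 2 * real n) * (real D * p)\<bar> \<le> (real L - 2 * real n) * (\<epsilon> / 2 * real D)"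
      using cI(1) L by (simp add: of_nat_diff)
    have "\<bar>real (card (A \<inter> {0..<int \<Lambda>})) - real \<Lambda> * p\<bar> \<le> \<epsilon> * real \<Lambda>"
    proof -
      have l1: "real \<Lambda> * p = (real L - 2 * real n) * (real D * p) + real D * real (P + 2 * n) * p"
        by (simp add: \<Lambda>_def b_def algebra_simps)
      have l2: "0 \<le> real D * real (P + 2 * n) * p" "real D * real (P + 2 * n) * p \<le> real D * real (P + 2 * n)"
        using p by (auto intro: mult_left_le)
      have l3: "(real L - 2 * real n) * (\<epsilon> / 2 * real D) \<le> real b * (\<epsilon> / 2 * real D)"
        using \<epsilon> by (intro mult_right_mono) (auto simp: b_def)
      have l4: "2 * (real D * real (P + 2 * n)) \<le> real D * (\<epsilon> / 2 * real b)"
        using mult_left_mono[OF b\<epsilon>, of "real D"] by (simp add: algebra_simps)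
      have l5: "real b * (\<epsilon> / 2 * real D) + real D * (\<epsilon> / 2 * real b) = \<epsilon> * real \<Lambda>"
        by (simp add: \<Lambda>_def)
      show ?thesis using good out l1 l2 l3 l4 l5 unfolding cA of_nat_add by linarith
    qed
    then have "\<bar>real (card (A \<inter> {0..<int \<Lambda>})) - real \<Lambda> * p\<bar> / real \<Lambda> \<le> \<epsilon>"
      using \<Lambda> by (simp add: divide_le_eq)
    moreover have "freq \<Lambda> A - p = (real (card (A \<inter> {0..<int \<Lambda>})) - real \<Lambda> * p) / real \<Lambda>"
      using \<Lambda> by (simp add: freq_def field_simps)
    ultimately show "\<bar>freq \<Lambda> {m. shift m w \<in> cylinder (int n) u} - measure M (X \<inter> cylinder (int n) u)\<bar> \<le> \<epsilon>"
      unfolding A_def[symmetric] p_def[symmetric] by (simp add: abs_divide)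
  qed
qed

section \<open>The weak topology in terms of windows\<close>

lemma compact_config: "compact (UNIV :: config set)"
proof -
  have "compact_space (euclidean :: bool topology)"
    by (simp add: compact_space_def finite_imp_compact)
  then have "compact_space (product_topology (\<lambda>i::int. euclidean :: bool topology) UNIV)"
    by (simp only: compact_space_product_topology) simp
  then have "compact_space (euclidean :: config topology)"
    by (simp only: euclidean_product_topology)
  then show ?thesis by (simp add: compact_space_def)
qed

lemma compact_subshift: "subshift X \<Longrightarrow> compact X"
  using compact_Int_closed[OF compact_config, of X] by (simp add: subshift_def)

lemma uniformly_continuous_window:
  fixes f :: "config \<Rightarrow> real"
  assumes X: "compact X" and f: "continuous_on X f" and \<epsilon>: "\<epsilon> > 0"
  obtains n where "\<And>x y. x \<in> X \<Longrightarrow> y \<in> X \<Longrightarrow> (\<forall>i\<in>{-n..n}. x i = y i) \<Longrightarrow> \<bar>f x - f y\<bar> \<le> \<epsilon>"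
proof -
  have "\<exists>n. \<forall>y\<in>X \<inter> cylinder n x. \<bar>f y - f x\<bar> < \<epsilon> / 2" if x: "x \<in> X" for x
  proof -
    have "open (ball (f x) (\<epsilon> / 2))" "f x \<in> ball (f x) (\<epsilon> / 2)" using \<epsilon> by auto
    then obtain U where U: "open U" "x \<in> U" "\<forall>y\<in>X. y \<in> U \<longrightarrow> f y \<in> ball (f x) (\<epsilon> / 2)"
      using f x unfolding continuous_on_topological by metis
    obtain n where n: "\<And>y. (\<forall>i\<in>{-n..n}. y i = x i) \<Longrightarrow> y \<in> U"
      using open_contains_window[OF U(1,2)] by blast
    have "\<bar>f y - f x\<bar> < \<epsilon> / 2" if "y \<in> X \<inter> cylinder n x" for y
    proof -
      have "y \<in> U" using n that by (simp add: cylinder_def)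
      then have "f y \<in> ball (f x) (\<epsilon> / 2)" using U(3) that by blast
      then show ?thesis by (simp add: dist_real_def abs_minus_commute)
    qed
    then show ?thesis by blast
  qed
  then obtain n where n: "\<And>x y. x \<in> X \<Longrightarrow> y \<in> X \<Longrightarrow> y \<in> cylinder (n x) x \<Longrightarrow> \<bar>f y - f x\<bar> < \<epsilon> / 2"
    by (metis IntI)
  have "X \<subseteq> (\<Union>x\<in>X. cylinder (n x) x)" by (auto simp: cylinder_def)
  then obtain C where C: "C \<subseteq> X" "finite C" "X \<subseteq> (\<Union>x\<in>C. cylinder (n x) x)"
    using compactE_image[OF X, of X "\<lambda>x. cylinder (n x) x"] open_cylinder by metis
  define m where "m = Max (n ` C)"
  show ?thesis
  proof
    fix x y assume xy: "x \<in> X" "y \<in> X" "\<forall>i\<in>{-m..m}. x i = y i"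
    obtain c where c: "c \<in> C" "x \<in> cylinder (n c) c" using C(3) xy(1) by blast
    have "n c \<le> m" unfolding m_def using C(2) c(1) by simp
    then have "y \<in> cylinder (n c) c" using c(2) xy(3) unfolding cylinder_def by auto
    then have "\<bar>f y - f c\<bar> < \<epsilon> / 2" "\<bar>f x - f c\<bar> < \<epsilon> / 2" using n c xy C(1) by blast+
    then show "\<bar>f x - f y\<bar> \<le> \<epsilon>" by linarith
  qed
qed

definition words :: "nat \<Rightarrow> config set" where
  "words n = {u. \<forall>i. u i \<longrightarrow> i \<in> {- int n..int n}}"

lemma finite_words: "finite (words n)"
proof (rule finite_imageD)
  have "Collect ` words n \<subseteq> Pow {- int n..int n}" by (auto simp: words_def)
  then show "finite (Collect ` words n)" by (rule finite_subset) simp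
  show "inj_on Collect (words n)" by (rule inj_onI) (erule Collect_inj)
qed

lemma ex1_word: "\<exists>!u. u \<in> words n \<and> x \<in> cylinder (int n) u"
proof (rule ex1I[of _ "\<lambda>i. i \<in> {- int n..int n} \<and> x i"])
  fix u assume u: "u \<in> words n \<and> x \<in> cylinder (int n) u"
  show "u = (\<lambda>i. i \<in> {- int n..int n} \<and> x i)"
  proof (rule ext)
    fix i
    show "u i = (i \<in> {- int n..int n} \<and> x i)"
      using u unfolding words_def cylinder_def by blast
  qed
qed (auto simp: words_def cylinder_def)

text \<open>A continuous function is nearly constant on the cylinders of a large window, so its integral is
  nearly a finite combination of their masses. Closeness of window statistics hence controls the
  weak topology.\<close>

lemma integral_step_approximation:
  fixes f :: "config \<Rightarrow> real"
  assumes M: "M \<in> invariant_measures X" and X: "subshift X" and f: "continuous_on X f"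
    and c: "\<And>x u. x \<in> X \<Longrightarrow> u \<in> words n \<Longrightarrow> x \<in> cylinder (int n) u \<Longrightarrow> \<bar>f x - c u\<bar> \<le> \<epsilon>"
  shows "\<bar>(\<integral>x. f x \<partial>M) - (\<Sum>u\<in>words n. c u * measure M (X \<inter> cylinder (int n) u))\<bar> \<le> \<epsilon>"
proof -
  interpret prob_space M by (rule invariant_measuresD[OF M])
  note sM = invariant_measuresD(1)[OF M] and sp = invariant_measuresD(4)[OF M]
  have Xb: "X \<in> sets borel" using X by (simp add: subshift_def borel_closed)
  have cyl: "X \<inter> cylinder (int n) u \<in> events" for u
    unfolding sM using cylinder_sets[of "int n" u] Xb by (subst sets_restrict_space_iff) auto
  have fm: "f \<in> borel_measurable M"
    using borel_measurable_continuous_on_restrict[OF f] measurable_cong_sets[OF sM refl] by blast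
  define g where "g x = (\<Sum>u\<in>words n. c u * indicator (X \<inter> cylinder (int n) u) x)" for x
  have fg: "\<bar>f x - g x\<bar> \<le> \<epsilon>" if x: "x \<in> X" for x
  proof -
    obtain v where v: "v \<in> words n" "x \<in> cylinder (int n) v"
      and uniq: "\<And>u. u \<in> words n \<Longrightarrow> x \<in> cylinder (int n) u \<Longrightarrow> u = v"
      using ex1_word[of n x] by blast
    have "g x = (\<Sum>u\<in>words n. if u = v then c v else 0)"
      unfolding g_def
    proof (intro sum.cong refl)
      fix u assume u: "u \<in> words n"
      show "c u * indicator (X \<inter> cylinder (int n) u) x = (if u = v then c v else 0)"
      proof (cases "u = v")
        case False
        then have "x \<notin> cylinder (int n) u" using uniq[OF u] by blast
        then show ?thesis using False by simp
      qed (use x v in simp)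
    qed
    also have "\<dots> = c v" using v finite_words by simp
    finally show ?thesis using c[OF x v] by simp
  qed
  have gi: "integrable M g" unfolding g_def using cyl
    by (intro Bochner_Integration.integrable_sum integrable_mult_right integrable_real_indicator) (auto simp: less_top[symmetric])
  have gint: "(\<integral>x. g x \<partial>M) = (\<Sum>u\<in>words n. c u * prob (X \<inter> cylinder (int n) u))"
    unfolding g_def using cyl
    by (subst Bochner_Integration.integral_sum) (auto simp: less_top[symmetric] sp Int_ac)
  have di: "integrable M (\<lambda>x. f x - g x)"
    by (rule integrable_const_bound[where B = \<epsilon>]) (use fm gi fg sp in auto)
  then have fi: "integrable M f" using Bochner_Integration.integrable_add[OF di gi] by simp
  have "\<bar>\<integral>x. (f x - g x) \<partial>M\<bar> \<le> (\<integral>x. \<bar>f x - g x\<bar> \<partial>M)" by (rule integral_abs_bound)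
  also have "\<dots> \<le> \<epsilon>" by (rule integral_le_const) (use di fg sp in \<open>auto intro!: AE_I2\<close>)
  finally show ?thesis using gint fi gi by simp
qed

lemma weak_topology_neighbourhood:
  assumes "openin (weak_topology X) U" "M \<in> U"
  shows "\<exists>F \<epsilon>. finite F \<and> (\<forall>f\<in>F. continuous_on X f) \<and> (\<epsilon>::real) > 0 \<and>
    (\<forall>\<nu>\<in>invariant_measures X. (\<forall>f\<in>F. \<bar>(\<integral>x. f x \<partial>\<nu>) - (\<integral>x. f x \<partial>M)\<bar> < \<epsilon>) \<longrightarrow> \<nu> \<in> U)"
proof -
  have "generate_topology_on {{M \<in> invariant_measures X. (\<integral>x. f x \<partial>M) \<in> U} | (f :: config \<Rightarrow> real) U.
      continuous_on X f \<and> open U} U"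
    using assms(1) unfolding weak_topology_def by (simp add: openin_topology_generated_by_iff)
  then show ?thesis using assms(2)
  proof (induction arbitrary: M)
    case Empty
    then show ?case by simp
  next
    case (Int U V)
    obtain F d where F: "finite F" "\<forall>f\<in>F. continuous_on X f" "(d::real) > 0"
      "\<forall>\<nu>\<in>invariant_measures X. (\<forall>f\<in>F. \<bar>(\<integral>x. f x \<partial>\<nu>) - (\<integral>x. f x \<partial>M)\<bar> < d) \<longrightarrow> \<nu> \<in> U"
      using Int.IH(1)[OF IntD1[OF Int.prems]] by (elim exE conjE) (rule that; assumption)
    obtain G e where G: "finite G" "\<forall>f\<in>G. continuous_on X f" "(e::real) > 0"
      "\<forall>\<nu>\<in>invariant_measures X. (\<forall>f\<in>G. \<bar>(\<integral>x. f x \<partial>\<nu>) - (\<integral>x. f x \<partial>M)\<bar> < e) \<longrightarrow> \<nu> \<in> V"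
      using Int.IH(2)[OF IntD2[OF Int.prems]] by (elim exE conjE) (rule that; assumption)
    show ?case
      by (rule exI[of _ "F \<union> G"], rule exI[of _ "min d e"]) (use F G in auto)
  next
    case (UN K)
    then obtain V where "V \<in> K" "M \<in> V" by blast
    from UN.IH[OF this] \<open>V \<in> K\<close> show ?case by (meson UnionI)
  next
    case (Basis s)
    obtain f :: "config \<Rightarrow> real" and V
      where f: "s = {M \<in> invariant_measures X. (\<integral>x. f x \<partial>M) \<in> V}" "continuous_on X f" "open V"
      using Basis.hyps by (elim CollectE exE conjE) (rule that)
    have "(\<integral>x. f x \<partial>M) \<in> V" using Basis.prems unfolding f(1) by simp
    then obtain e where e: "e > 0" "\<forall>y. dist y (\<integral>x. f x \<partial>M) < e \<longrightarrow> y \<in> V"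
      using f(3) unfolding open_dist by blast
    show ?case
    proof (intro exI[of _ "{f}"] exI[of _ e] conjI ballI impI)
      fix \<nu> assume "\<nu> \<in> invariant_measures X" "\<forall>f\<in>{f}. \<bar>(\<integral>x. f x \<partial>\<nu>) - (\<integral>x. f x \<partial>M)\<bar> < e"
      then show "\<nu> \<in> s" using e(2) unfolding f(1) by (simp add: dist_real_def)
    qed (use f e in simp_all)
  qed
qed

lemma weakly_dense_if_words_approximable:
  assumes X: "subshift X" and S: "S \<subseteq> invariant_measures X"
    and approx: "\<And>M n \<delta>. M \<in> invariant_measures X \<Longrightarrow> \<delta> > 0 \<Longrightarrow> \<exists>\<nu>\<in>S. \<forall>u\<in>words n.
      \<bar>measure \<nu> (X \<inter> cylinder (int n) u) - measure M (X \<inter> cylinder (int n) u)\<bar> \<le> \<delta>"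
  shows "weak_topology X closure_of S = topspace (weak_topology X)"
proof (rule antisym[OF closure_of_subset_topspace], rule subsetI)
  fix M assume "M \<in> topspace (weak_topology X)"
  then have M: "M \<in> invariant_measures X" by (simp add: topspace_weak_topology)
  have "\<exists>\<nu>\<in>S. \<nu> \<in> U" if U: "openin (weak_topology X) U" "M \<in> U" for U
  proof -
    obtain F \<epsilon> where F': "finite F" "\<forall>f\<in>F. continuous_on X f" "(\<epsilon>::real) > 0"
      and FU': "\<forall>\<nu>\<in>invariant_measures X. (\<forall>f\<in>F. \<bar>(\<integral>x. f x \<partial>\<nu>) - (\<integral>x. f x \<partial>M)\<bar> < \<epsilon>) \<longrightarrow> \<nu> \<in> U"
      using weak_topology_neighbourhood[OF U] by (elim exE conjE) (rule that; assumption)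
    have F: "finite F" "\<And>f. f \<in> F \<Longrightarrow> continuous_on X f" "\<epsilon> > 0" using F' by auto
    have FU: "\<nu> \<in> U" if "\<nu> \<in> invariant_measures X" "\<And>f. f \<in> F \<Longrightarrow> \<bar>(\<integral>x. f x \<partial>\<nu>) - (\<integral>x. f x \<partial>M)\<bar> < \<epsilon>" for \<nu>
      using FU' that by blast
    have "\<forall>f\<in>F. \<exists>n. \<forall>x\<in>X. \<forall>y\<in>X. (\<forall>i\<in>{-n..n}. x i = y i) \<longrightarrow> \<bar>f x - f y\<bar> \<le> \<epsilon> / 4"
      using uniformly_continuous_window[OF compact_subshift[OF X] F(2), of _ "\<epsilon> / 4"] F(3) by (metis zero_less_divide_iff zero_less_numeral)
    then obtain nf where nf: "\<And>f x y. f \<in> F \<Longrightarrow> x \<in> X \<Longrightarrow> y \<in> X \<Longrightarrow> (\<forall>i\<in>{-nf f..nf f}. x i = y i) \<Longrightarrow> \<bar>f x - f y\<bar> \<le> \<epsilon> / 4"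
      by metis
    define n where "n = nat (Max (insert 0 (nf ` F)))"
    have n: "nf f \<le> int n" if "f \<in> F" for f
      using F(1) that unfolding n_def by (simp add: Max_ge_iff le_nat_iff)
    define rep where "rep u = (SOME x. x \<in> X \<inter> cylinder (int n) u)" for u
    have rep: "rep u \<in> X \<inter> cylinder (int n) u" if "x \<in> X" "x \<in> cylinder (int n) u" for x u
      unfolding rep_def by (rule someI[of _ x]) (use that in blast)
    have close: "\<bar>f x - f (rep u)\<bar> \<le> \<epsilon> / 4" if "f \<in> F" "x \<in> X" "x \<in> cylinder (int n) u" for f x u
    proof (rule nf[OF that(1,2)])
      show "rep u \<in> X" using rep[OF that(2,3)] by simp
      show "\<forall>i\<in>{-nf f..nf f}. x i = rep u i"
        using rep[OF that(2,3)] that(3) n[OF that(1)] by (auto simp: cylinder_def)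
    qed
    define C where "C = (\<Sum>f\<in>F. \<Sum>u\<in>words n. \<bar>f (rep u)\<bar>)"
    have C0: "C \<ge> 0" unfolding C_def by (intro sum_nonneg) auto
    have C: "(\<Sum>u\<in>words n. \<bar>f (rep u)\<bar>) \<le> C" if "f \<in> F" for f
      unfolding C_def using that F(1) by (intro member_le_sum) (auto intro: sum_nonneg)
    define \<delta> where "\<delta> = \<epsilon> / (4 * (C + 1))"
    have \<delta>: "\<delta> > 0" "C * \<delta> \<le> \<epsilon> / 4" using C0 F(3) by (auto simp: \<delta>_def field_simps)
    obtain \<nu> where \<nu>: "\<nu> \<in> S" "\<And>u. u \<in> words n \<Longrightarrow>
      \<bar>measure \<nu> (X \<inter> cylinder (int n) u) - measure M (X \<inter> cylinder (int n) u)\<bar> \<le> \<delta>"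
      using approx[OF M \<delta>(1), of n] by blast
    have \<nu>i: "\<nu> \<in> invariant_measures X" using S \<nu>(1) by blast
    have "\<nu> \<in> U"
    proof (rule FU[OF \<nu>i])
      fix f assume f: "f \<in> F"
      let ?I = "\<lambda>K. \<Sum>u\<in>words n. f (rep u) * measure K (X \<inter> cylinder (int n) u)"
      have a: "\<bar>(\<integral>x. f x \<partial>\<nu>) - ?I \<nu>\<bar> \<le> \<epsilon> / 4"
        by (rule integral_step_approximation[OF \<nu>i X F(2)[OF f] close[OF f]])
      have b: "\<bar>(\<integral>x. f x \<partial>M) - ?I M\<bar> \<le> \<epsilon> / 4"
        by (rule integral_step_approximation[OF M X F(2)[OF f] close[OF f]])
      have "\<bar>?I \<nu> - ?I M\<bar> = \<bar>\<Sum>u\<in>words n. f (rep u) * (measure \<nu> (X \<inter> cylinder (int n) u) - measure M (X \<inter> cylinder (int n) u))\<bar>"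
        by (simp add: sum_subtractf right_diff_distrib)
      also have "\<dots> \<le> (\<Sum>u\<in>words n. \<bar>f (rep u)\<bar> * \<delta>)"
        by (rule order_trans[OF sum_abs], rule sum_mono) (auto simp: abs_mult intro!: mult_left_mono \<nu>(2))
      also have "\<dots> = (\<Sum>u\<in>words n. \<bar>f (rep u)\<bar>) * \<delta>" by (simp add: sum_distrib_right)
      also have "\<dots> \<le> C * \<delta>" using C[OF f] \<delta> by (intro mult_right_mono) auto
      finally show "\<bar>(\<integral>x. f x \<partial>\<nu>) - (\<integral>x. f x \<partial>M)\<bar> < \<epsilon>" using a b \<delta>(2) F(3) by linarith
    qed
    then show ?thesis using \<nu>(1) by blast
  qed
  then show "M \<in> weak_topology X closure_of S"
    using M unfolding in_closure_of by (auto simp: topspace_weak_topology)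
qed

section \<open>Density of the extreme measures\<close>

lemma extreme_measures_subset: "extreme_measures P \<subseteq> P"
  by (auto simp: extreme_measures_def)

text \<open>First fix \<open>K\<close> so that the sieve by \<open>b \<ge> K\<close> hardly changes window statistics. Points of the orbit
  closure lie below translates of the periodic set sieved by \<open>b < K\<close>, so \<open>M\<close> has a periodic model \<open>w\<close>
  below this set; sieving \<open>w\<close> by all of \<open>B\<close> returns to the orbit closure and yields an extreme measure
  with nearly the same statistics.\<close>

lemma extreme_measure_approximation:
  assumes B0: "0 \<notin> B" and light: "(\<lambda>K. upper_density (tail B K)) \<longlonglongrightarrow> 0"
    and her: "hereditary (orbit_closure (eta B))"
    and M: "M \<in> invariant_measures (orbit_closure (eta B))" and \<delta>: "\<delta> > 0"
  shows "\<exists>\<nu>\<in>extreme_measures (invariant_measures (orbit_closure (eta B))). \<forall>u\<in>words n.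
    \<bar>measure \<nu> (orbit_closure (eta B) \<inter> cylinder (int n) u) -
      measure M (orbit_closure (eta B) \<inter> cylinder (int n) u)\<bar> \<le> \<delta>"
proof -
  define e where "e = \<delta> / (2 * real (card {- int n..int n}))"
  have ne: "card {- int n..int n} > 0" by simp
  have e: "e > 0" "real (card {- int n..int n}) * e = \<delta> / 2"
    using \<delta> ne unfolding e_def by (simp_all del: card_atLeastAtMost_int)
  obtain K where K: "upper_density (tail B K) \<le> ereal e"
    using light_tails_eventually[OF light e(1)] unfolding eventually_sequentially by blast
  have below: "\<exists>k. \<forall>i\<in>{0..<int L}. x i \<longrightarrow> eta {b\<in>B. b < K} (i + k)"
    if x: "x \<in> orbit_closure (eta B)" for x L
  proof -
    obtain k where k: "\<forall>i\<in>{- int L..int L}. x i = eta B (i + k)" using x unfolding orbit_closure_iff by blast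
    then have "\<forall>i\<in>{0..<int L}. x i \<longrightarrow> eta {b\<in>B. b < K} (i + k)" by (simp add: eta_iff)
    then show ?thesis by blast
  qed
  obtain \<Lambda> w where w: "periodic \<Lambda> {m. w m}" "\<And>m. w m \<Longrightarrow> eta {b\<in>B. b < K} m"
    and fr: "\<And>u. u \<in> words n \<Longrightarrow> \<bar>freq \<Lambda> {m. shift m w \<in> cylinder (int n) u} -
      measure M (orbit_closure (eta B) \<inter> cylinder (int n) u)\<bar> \<le> \<delta> / 2"
    using periodic_model[OF M subshift_orbit_closure eta_periodic[OF B0, of K] below finite_words, of "\<delta> / 2" n n] \<delta> by auto
  define N where "N = max K \<Lambda>"
  have KN: "K \<le> N" by (simp add: N_def)
  have "\<Lambda> > 0" using w by (simp add: periodic_def)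
  then have dv: "\<Lambda> dvd fact N" by (intro dvd_fact) (auto simp: N_def)
  have per: "periodic (fact N) {m. w m}" by (rule periodic_dvd[OF w(1) dv]) simp
  have freq: "freq (fact N) {m. shift m w \<in> cylinder (int n) u} = freq \<Lambda> {m. shift m w \<in> cylinder (int n) u}" for u
  proof (rule freq_multiple[OF _ dv])
    have "shift m w = (\<lambda>i. w (m + i))" for m by (simp add: shift_def add.commute)
    then show "periodic \<Lambda> {m. shift m w \<in> cylinder (int n) u}"
      using periodic_window[OF w(1), of "\<lambda>x. x \<in> cylinder (int n) u"] by simp
  qed simp
  obtain \<nu> where \<nu>: "\<nu> \<in> extreme_measures (invariant_measures (orbit_closure (eta B)))"
    "\<And>u. \<bar>measure \<nu> (orbit_closure (eta B) \<inter> cylinder (int n) u) - freq (fact N) {m. shift m w \<in> cylinder (int n) u}\<bar>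
      \<le> real (card {- int n..int n}) * e"
    using sieve_measure_exists[OF B0 light her per w(2) KN K less_imp_le[OF e(1)]] by blast
  have "\<bar>measure \<nu> (orbit_closure (eta B) \<inter> cylinder (int n) u) -
      measure M (orbit_closure (eta B) \<inter> cylinder (int n) u)\<bar> \<le> \<delta>" if u: "u \<in> words n" for u
    using \<nu>(2)[of u] fr[OF u] unfolding freq e(2) by linarith
  then show ?thesis using \<nu>(1) by blast
qed

text \<open>The empty mask gives the point mass at the zero sequence. The full periodic sieve by \<open>b < K\<close> gives, for
  large \<open>K\<close>, a measure that charges \<open>x 0 = 1\<close> with nearly at least the density of the \<open>B\<close>-free set.\<close>

lemma two_invariant_measures:
  assumes B0: "0 \<notin> B" and light: "(\<lambda>K. upper_density (tail B K)) \<longlonglongrightarrow> 0"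
    and her: "hereditary (orbit_closure (eta B))" and pos: "upper_density (free_set B) > 0"
  shows "\<exists>M\<in>invariant_measures (orbit_closure (eta B)).
    \<exists>N\<in>invariant_measures (orbit_closure (eta B)). M \<noteq> N"
proof -
  let ?X = "orbit_closure (eta B)"
  obtain r where r: "0 < ereal r" "ereal r < upper_density (free_set B)" using ereal_dense2[OF pos] by blast
  define e where "e = r / 3"
  have e: "e > 0" using r by (simp add: e_def)
  obtain K where K: "upper_density (tail B K) \<le> ereal e"
    using light_tails_eventually[OF light e] unfolding eventually_sequentially by blast
  define w where "w m = eta {b\<in>B. b < K} m" for m
  define u where "u i = (i = 0)" for i :: int
  have per: "periodic (fact K) {m. w m}" unfolding w_def by (rule eta_periodic[OF B0])
  have "upper_density (free_set B) \<le> upper_density {m. w m}"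
    by (rule upper_density_mono) (auto simp: w_def eta_def free_set_def)
  then have fr: "r < freq (fact K) {m. w m}"
    using r(2) upper_density_periodic[OF per] by (metis ereal_less(2) less_ereal.simps(1) less_le_trans)
  have sh: "{m. shift m v \<in> cylinder 0 u} = {m. v m}" for v by (auto simp: shift_def cylinder_def u_def)
  have c1: "real (card {- 0..0::int}) = 1" by simp
  have wK: "w m \<Longrightarrow> eta {b\<in>B. b < K} m" for m by (simp add: w_def)
  obtain M where M: "M \<in> extreme_measures (invariant_measures ?X)"
    "\<bar>measure M (?X \<inter> cylinder 0 u) - freq (fact K) {m. shift m w \<in> cylinder 0 u}\<bar> \<le> real (card {- 0..0::int}) * e"
    using sieve_measure_exists[OF B0 light her per wK order_refl K less_imp_le[OF e]] by blast
  have per0: "periodic (fact K) {m::int. False}" by (simp add: periodic_def)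
  obtain N where N: "N \<in> extreme_measures (invariant_measures ?X)"
    "\<bar>measure N (?X \<inter> cylinder 0 u) - freq (fact K) {m. shift m (\<lambda>_. False) \<in> cylinder 0 u}\<bar> \<le> real (card {- 0..0::int}) * e"
    using sieve_measure_exists[OF B0 light her per0 _ order_refl K less_imp_le[OF e]] by blast
  have "measure M (?X \<inter> cylinder 0 u) \<ge> r - e" using M(2) fr unfolding sh c1 by linarith
  moreover have "measure N (?X \<inter> cylinder 0 u) \<le> e"
    using N(2) unfolding sh c1 by (simp add: freq_def)
  ultimately have "M \<noteq> N" using e by (auto simp: e_def)
  then show ?thesis using M(1) N(1) extreme_measures_subset by blast
qed

theorem corollary3:
  fixes B :: "nat set"
  assumes "0 \<notin> B"
    and "upper_density (free_set B) > 0"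
    and "(\<lambda>K::nat. upper_density (\<Union>b\<in>{b\<in>B. b \<ge> K}. multiples b)) \<longlonglongrightarrow> 0"
    and "\<exists>C\<subseteq>B. infinite C \<and> pairwise coprime C"
  shows "hereditary (orbit_closure (eta B)) \<and>
    poulsen (weak_topology (orbit_closure (eta B)))"
proof
  have light: "(\<lambda>K. upper_density (tail B K)) \<longlonglongrightarrow> 0"
    using assms(3) by (simp add: tail_def)
  obtain C where C: "C \<subseteq> B" "infinite C" "pairwise coprime C" using assms(4) by blast
  show her: "hereditary (orbit_closure (eta B))"
    by (rule hereditary_orbit_closure_eta[OF assms(1) light C])
  show "poulsen (weak_topology (orbit_closure (eta B)))"
    unfolding poulsen_def
  proof
    show "\<exists>M\<in>topspace (weak_topology (orbit_closure (eta B))).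
        \<exists>N\<in>topspace (weak_topology (orbit_closure (eta B))). M \<noteq> N"
      using two_invariant_measures[OF assms(1) light her assms(2)] by (simp add: topspace_weak_topology)
    show "weak_topology (orbit_closure (eta B)) closure_of
        extreme_measures (topspace (weak_topology (orbit_closure (eta B)))) =
      topspace (weak_topology (orbit_closure (eta B)))"
      unfolding topspace_weak_topology[of "orbit_closure (eta B)"]
      by (subst topspace_weak_topology[symmetric],
          rule weakly_dense_if_words_approximable[OF subshift_orbit_closure extreme_measures_subset
            extreme_measure_approximation[OF assms(1) light her]])
  qed
qed

end
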